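(* The pattern subgroup $U_{P_\diamond}(q)$ of $U_{13}(q)$ embeds into $U_{59}(q)$; that is, the 13-element poset $P_\diamond$ embeds into the chain $\mathcal{C}^{59}$ (in symbols $P_\diamond\rightsquigarrow\mathcal{C}^{59}$).
   Context: All posets are finite. $\mathcal{C}^n$ is the $n$-element chain. For $x$ in a poset $P$, $\mathrm{lb}(x)=\{y\in P: y\prec x\}$; $\max(P)$ is the set of maximal elements; $\mathrm{ac}(X)$ is the set of antichains contained in $X$ (including $\varnothing$). The poset $P_\diamond$ has 13 elements: minimal elements $b_1,b_2,b_3,b_4$; middle elements $c_{12},c_{13},c_{14},c_{23},c_{24},c_{34}$; maximal elements $t_1,t_2,t_3$. Its cover relations are: $b_i\prec c_{ij}$ and $b_j\prec c_{ij}$ for all $1\le i<j\le 4$; $c_{13},c_{14},c_{23},c_{24}\prec t_1$; $c_{12},c_{14},c_{23},c_{34}\prec t_2$; $c_{12},c_{13},c_{24},c_{34}\prec t_3$. Pattern groups. For a poset $P$, label its elements by $1,\dots,n$ so that $i\preceq_P j$ implies $i\le j$ (the quantities below do not depend on the labelling). Let $e_{i,j}$ be the matrix units of $M_{n\times n}(\mathbb{F}_q)$. Put $\mathcal{U}_P(q)=\{X\in M_{n\times n}(\mathbb{F}_q): X_{i,j}=0\text{ if }i\not\prec_P j\}$, $U_P(q)=\{1+X:X\in\mathcal{U}_P(q)\}$, and let $k(P)=k(U_P(q))$ be the number of conjugacy classes of $U_P(q)$, as a function of the prime power $q$. Thus $U_{\mathcal{C}^n}(q)=U_n(q)$, the group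 of unitriangular $n\times n$ matrices over $\mathbb{F}_q$. Let $\mathcal{L}_P(q)=M_{n\times n}(\mathbb{F}_q)/\bigoplus_{i\not\succ_P j}\mathbb{F}_q e_{i,j}$. The group $U_P(q)$ acts on $\mathcal{L}_P(q)$ by the co-adjoint action $K_g(L)=gLg^{-1}$ (conjugate any matrix representative and project back). Poset systems. A poset system is a triple $S=(P,m,A)$ with $P$ a poset, $m\in\max(P)$, and $A\in\mathrm{ac}(\mathrm{lb}(m))$. Let $Q=P^{(m)}$ be the poset on the ground set of $P$ whose only relations are $x\prec m$ for $x\prec_P m$, and let $\pi:\mathcal{L}_P\to\mathcal{L}_Q$ be the canonical projection, killing all $e_{i,j}$ not of the form $e_{m,x}$ with $x\prec_P m$. Then $U_P$ acts on $\mathcal{L}_Q$ through $\pi$. With $1_A=\sum_{a\in A}e_{m,a}\in\mathcal{L}_Q$, let $k(S)=k(P,m,A)$ be the number of orbits of $\mathrm{stab}_{U_P}(1_A)$ on $\pi^{-1}(1_A)$, as a function of $q$. Embedding. A poset $P$ embeds into a poset $Q$, written $P\rightsquigarrow Q$, if there exist posets $P_0,P_1,\dots,P_n$ and poset systems $S_1,\dots,S_n$ with $S_i=(P_i,m_i,A_i)$ such that $P_0=P$, $P_n=Q$, and $k(P_i)=k(S_{i+1})$ (as functions of $q$) for $0\le i<n$. Posets are considered up to isomorphism. *)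

theory Defs
  imports "HOL-Algebra.Group_Action" "HOL-Algebra.AbelCoset"
begin

text \<open>A poset is its (reflexive) order relation; the ground set is the field of the relation.\<close>

definition finite_poset :: "'a rel \<Rightarrow> bool" where
  "finite_poset P \<longleftrightarrow> Partial_order P \<and> finite (Field P)"

definition less_in :: "'a rel \<Rightarrow> 'a \<Rightarrow> 'a \<Rightarrow> bool" where
  "less_in P x y \<longleftrightarrow> (x, y) \<in> P \<and> x \<noteq> y"

definition poset_iso :: "'a rel \<Rightarrow> 'b rel \<Rightarrow> bool" where
  "poset_iso P Q \<longleftrightarrow> (\<exists>f. bij_betw f (Field P) (Field Q) \<and>
     (\<forall>x\<in>Field P. \<forall>y\<in>Field P. (x, y) \<in> P \<longleftrightarrow> (f x, f y) \<in> Q))"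

definition lower_bounds :: "'a rel \<Rightarrow> 'a \<Rightarrow> 'a set" where
  "lower_bounds P x = {y \<in> Field P. less_in P y x}"

definition max_elements :: "'a rel \<Rightarrow> 'a set" where
  "max_elements P = {x \<in> Field P. \<not> (\<exists>y\<in>Field P. less_in P x y)}"

definition antichains :: "'a rel \<Rightarrow> 'a set \<Rightarrow> 'a set set" where
  "antichains P X = {A. A \<subseteq> X \<and> (\<forall>x\<in>A. \<forall>y\<in>A. \<not> less_in P x y)}"

definition chain_poset :: "nat \<Rightarrow> nat rel" where
  "chain_poset n = {(i, j). 1 \<le> i \<and> i \<le> j \<and> j \<le> n}"

datatype diamond_elem = B nat | C nat nat | T nat

definition diamond_ground :: "diamond_elem set" where
  "diamond_ground = {B 1, B 2, B 3, B 4,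
     C 1 2, C 1 3, C 1 4, C 2 3, C 2 4, C 3 4, T 1, T 2, T 3}"

definition diamond_covers :: "diamond_elem rel" where
  "diamond_covers =
     {(B i, C i j) | i j. 1 \<le> i \<and> i < j \<and> j \<le> 4} \<union>
     {(B j, C i j) | i j. 1 \<le> i \<and> i < j \<and> j \<le> 4} \<union>
     {C 1 3, C 1 4, C 2 3, C 2 4} \<times> {T 1} \<union>
     {C 1 2, C 1 4, C 2 3, C 3 4} \<times> {T 2} \<union>
     {C 1 2, C 1 3, C 2 4, C 3 4} \<times> {T 3}"

definition diamond_poset :: "diamond_elem rel" where
  "diamond_poset = Id_on diamond_ground \<union> diamond_covers\<^sup>+"


text \<open>
  The ring of square matrices over \<open>K\<close> whose rows and columns are indexed by a finite set \<open>V\<close>,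
  with entries outside \<open>V \<times> V\<close> set to zero. Taking for \<open>V\<close> the ground set of a poset replaces
  the choice of a labelling of its elements by \<open>1, \<dots>, n\<close>.
\<close>

definition mat_ring :: "('k, 'r) ring_scheme \<Rightarrow> 'a set \<Rightarrow> ('a \<Rightarrow> 'a \<Rightarrow> 'k) ring" where
  "mat_ring K V =
     \<lparr>carrier = {X. \<forall>i j. X i j \<in> carrier K \<and> (i \<notin> V \<or> j \<notin> V \<longrightarrow> X i j = \<zero>\<^bsub>K\<^esub>)},
      mult = (\<lambda>X Y i j. \<Oplus>\<^bsub>K\<^esub>k\<in>V. X i k \<otimes>\<^bsub>K\<^esub> Y k j),
      one = (\<lambda>i j. if i = j \<and> i \<in> V then \<one>\<^bsub>K\<^esub> else \<zero>\<^bsub>K\<^esub>),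
      zero = (\<lambda>i j. \<zero>\<^bsub>K\<^esub>),
      add = (\<lambda>X Y i j. X i j \<oplus>\<^bsub>K\<^esub> Y i j)\<rparr>"

abbreviation poset_mat_ring :: "('k, 'r) ring_scheme \<Rightarrow> 'a rel \<Rightarrow> ('a \<Rightarrow> 'a \<Rightarrow> 'k) ring" where
  "poset_mat_ring K P \<equiv> mat_ring K (Field P)"

definition mat_unit :: "('k, 'r) ring_scheme \<Rightarrow> 'a \<Rightarrow> 'a \<Rightarrow> 'a \<Rightarrow> 'a \<Rightarrow> 'k" where
  "mat_unit K r c = (\<lambda>i j. if i = r \<and> j = c then \<one>\<^bsub>K\<^esub> else \<zero>\<^bsub>K\<^esub>)"

definition pattern_algebra :: "('k, 'r) ring_scheme \<Rightarrow> 'a rel \<Rightarrow> ('a \<Rightarrow> 'a \<Rightarrow> 'k) set" where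
  "pattern_algebra K P =
     {X \<in> carrier (poset_mat_ring K P). \<forall>i j. \<not> less_in P i j \<longrightarrow> X i j = \<zero>\<^bsub>K\<^esub>}"

definition pattern_group :: "('k, 'r) ring_scheme \<Rightarrow> 'a rel \<Rightarrow> ('a \<Rightarrow> 'a \<Rightarrow> 'k) monoid" where
  "pattern_group K P =
     \<lparr>carrier = {\<one>\<^bsub>poset_mat_ring K P\<^esub> \<oplus>\<^bsub>poset_mat_ring K P\<^esub> X | X. X \<in> pattern_algebra K P},
      mult = mult (poset_mat_ring K P),
      one = \<one>\<^bsub>poset_mat_ring K P\<^esub>\<rparr>"

definition poset_classes :: "('k, 'r) ring_scheme \<Rightarrow> 'a rel \<Rightarrow> nat" where
  "poset_classes K P =
     (let U = pattern_group K P
      in card (orbits U (carrier U) (\<lambda>g. \<lambda>h\<in>carrier U. g \<otimes>\<^bsub>U\<^esub> h \<otimes>\<^bsub>U\<^esub> inv\<^bsub>U\<^esub> g)))"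


text \<open>
  The space \<open>\<L>\<^sub>P\<close> is the quotient of the matrix space by \<open>coadj_kernel K P\<close>, the span of the matrix
  units \<open>e\<^sub>i\<^sub>j\<close> with \<open>i\<close> not above \<open>j\<close>. Its elements are additive cosets, and maps on cosets are
  given as unions over all representatives.
\<close>

definition coadj_kernel :: "('k, 'r) ring_scheme \<Rightarrow> 'a rel \<Rightarrow> ('a \<Rightarrow> 'a \<Rightarrow> 'k) set" where
  "coadj_kernel K P =
     {X \<in> carrier (poset_mat_ring K P). \<forall>i j. less_in P j i \<longrightarrow> X i j = \<zero>\<^bsub>K\<^esub>}"

definition coadj_space :: "('k, 'r) ring_scheme \<Rightarrow> 'a rel \<Rightarrow> ('a \<Rightarrow> 'a \<Rightarrow> 'k) set set" where
  "coadj_space K P = a_rcosets\<^bsub>poset_mat_ring K P\<^esub> (coadj_kernel K P)"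

definition coadj_action ::
    "('k, 'r) ring_scheme \<Rightarrow> 'a rel \<Rightarrow> ('a \<Rightarrow> 'a \<Rightarrow> 'k) \<Rightarrow> ('a \<Rightarrow> 'a \<Rightarrow> 'k) set \<Rightarrow> ('a \<Rightarrow> 'a \<Rightarrow> 'k) set" where
  "coadj_action K P g L =
     (let M = poset_mat_ring K P
      in \<Union>X\<in>L. coadj_kernel K P +>\<^bsub>M\<^esub> (g \<otimes>\<^bsub>M\<^esub> X \<otimes>\<^bsub>M\<^esub> inv\<^bsub>pattern_group K P\<^esub> g))"


definition poset_system :: "'a rel \<Rightarrow> 'a \<Rightarrow> 'a set \<Rightarrow> bool" where
  "poset_system P m A \<longleftrightarrow>
     finite_poset P \<and> m \<in> max_elements P \<and> A \<in> antichains P (lower_bounds P m)"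

definition below_poset :: "'a rel \<Rightarrow> 'a \<Rightarrow> 'a rel" where
  "below_poset P m = Id_on (Field P) \<union> {(x, m) | x. less_in P x m}"

definition below_proj ::
    "('k, 'r) ring_scheme \<Rightarrow> 'a rel \<Rightarrow> 'a \<Rightarrow> ('a \<Rightarrow> 'a \<Rightarrow> 'k) set \<Rightarrow> ('a \<Rightarrow> 'a \<Rightarrow> 'k) set" where
  "below_proj K P m L =
     (\<Union>X\<in>L. coadj_kernel K (below_poset P m) +>\<^bsub>poset_mat_ring K P\<^esub> X)"

text \<open>The action of the pattern group of \<open>P\<close> on \<open>\<L>\<^sub>Q\<close>, for \<open>Q = below_poset P m\<close>, that is induced
  by the co-adjoint action along the projection.\<close>

definition below_action ::
    "('k, 'r) ring_scheme \<Rightarrow> 'a rel \<Rightarrow> 'a \<Rightarrow> ('a \<Rightarrow> 'a \<Rightarrow> 'k) \<Rightarrow>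
       ('a \<Rightarrow> 'a \<Rightarrow> 'k) set \<Rightarrow> ('a \<Rightarrow> 'a \<Rightarrow> 'k) set" where
  "below_action K P m g N =
     (\<Union>L\<in>{L \<in> coadj_space K P. below_proj K P m L = N}. below_proj K P m (coadj_action K P g L))"

definition antichain_point ::
    "('k, 'r) ring_scheme \<Rightarrow> 'a rel \<Rightarrow> 'a \<Rightarrow> 'a set \<Rightarrow> ('a \<Rightarrow> 'a \<Rightarrow> 'k) set" where
  "antichain_point K P m A =
     (let M = poset_mat_ring K P
      in coadj_kernel K (below_poset P m) +>\<^bsub>M\<^esub> (\<Oplus>\<^bsub>M\<^esub>a\<in>A. mat_unit K m a))"

definition system_orbits :: "('k, 'r) ring_scheme \<Rightarrow> 'a rel \<Rightarrow> 'a \<Rightarrow> 'a set \<Rightarrow> nat" where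
  "system_orbits K P m A =
     (let U = pattern_group K P;
          H = stabilizer U (below_action K P m) (antichain_point K P m A);
          E = {L \<in> coadj_space K P. below_proj K P m L = antichain_point K P m A}
      in card (orbits (U\<lparr>carrier := H\<rparr>) E (coadj_action K P)))"


text \<open>
  Two counts agree as functions of the prime power \<open>q\<close> if they agree for every finite field. As every
  finite set can be injected into the naturals, it suffices to let the intermediate posets and the
  finite fields range over structures on natural numbers. The sequence of posets is determined up
  to isomorphism only, so its ends are merely required to be isomorphic to \<open>P\<close> and \<open>Q\<close>.
\<close>

definition embeds :: "'a rel \<Rightarrow> 'b rel \<Rightarrow> bool" (infix \<open>\<leadsto>\<close> 50) where
  "P \<leadsto> Q \<longleftrightarrow>
     (\<exists>n (R :: nat \<Rightarrow> nat rel) (m :: nat \<Rightarrow> nat) (A :: nat \<Rightarrow> nat set).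
        (\<forall>i\<le>n. finite_poset (R i)) \<and> poset_iso P (R 0) \<and> poset_iso (R n) Q \<and>
        (\<forall>i\<in>{1..n}. poset_system (R i) (m i) (A i)) \<and>
        (\<forall>i<n. \<forall>K :: nat ring. field K \<and> finite (carrier K) \<longrightarrow>
           poset_classes K (R i) = system_orbits K (R (i + 1)) (m (i + 1)) (A (i + 1))))"

end

theory Submission
  imports Defs
begin

text \<open>
  Let \<open>m\<close> be maximal in \<open>P\<close> and \<open>a\<close> below \<open>m\<close>. For the antichain \<open>{a}\<close> the stabilizer of the point
  consists of the matrices with vanishing entries \<open>(a, y)\<close> for \<open>y\<close> below \<open>m\<close>, and the entries in column \<open>m\<close>
  act on the fibre by translating the coordinates \<open>(y, a)\<close>. Hence \<open>k(P, m, {a}) = k(Q)\<close>, where \<open>Q\<close> arises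
  from \<open>P\<close> by deleting \<open>m\<close> and the relations between \<open>a\<close> and the \<open>y\<close> with \<open>a < y < m\<close>. Both sides are
  computed by Burnside's lemma, so only pairs of a group element and a fixed point are counted. The
  numbers of fixed points of \<open>1 + X\<close> for conjugation and for the co-adjoint action agree because the
  trace form makes the two linear conditions transposes of each other.

  Such reductions lead from the chain with 36 elements down to the diamond poset in 23 steps, and the
  chain with \<open>n + 1\<close> elements reduces to the one with \<open>n\<close> elements by \<open>m = n + 1\<close>, \<open>a = n\<close>.
\<close>

section \<open>Matrices over a field\<close>

text \<open>The obstacle is that the two sides count orbits of different groups on different spaces:
  conjugation on a group for \<open>Q\<close>, and a larger group acting on an affine fibre for
  \<open>(P, m, {a})\<close>. No bijection of orbits is built. After Burnside both sides are numbers
  of pairs subject to bilinear equations, and the excess is the same power of q twice. The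
  stabilizer has one extra coordinate \<open>X i m\<close> for each \<open>i\<close> below
  \<open>m\<close>. A fixed pair also has one extra free coordinate for each such \<open>i\<close>:
  it is \<open>Z i a\<close> if \<open>i\<close> lies strictly between \<open>a\<close> and
  \<open>m\<close>, since there an equation with coefficient \<open>Z m a = 1\<close> forces
  \<open>X i m\<close>, and it is \<open>X i m\<close> otherwise. The common factor cancels. Only
  single-element antichains occur because there the stabilizer condition kills individual entries of
  row \<open>a\<close>, so the result is again described by a poset. A larger antichain would
  constrain sums of rows instead. Each reduction deletes one element. Thus 23 steps lead from 13 to
  36 elements, and 23 further steps merely pad the chain from 36 to 59.\<close>

lemma (in abelian_monoid) finsum_swap:
  assumes "finite I" "finite J" and f: "\<And>i j. i \<in> I \<Longrightarrow> j \<in> J \<Longrightarrow> f i j \<in> carrier G"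
  shows "(\<Oplus>i\<in>I. \<Oplus>j\<in>J. f i j) = (\<Oplus>j\<in>J. \<Oplus>i\<in>I. f i j)"
  using assms(1) f
proof (induction I rule: finite_induct)
  case (insert x I)
  have "(\<Oplus>i\<in>insert x I. \<Oplus>j\<in>J. f i j) = (\<Oplus>j\<in>J. f x j) \<oplus> (\<Oplus>i\<in>I. \<Oplus>j\<in>J. f i j)"
    using insert by (intro finsum_insert) (auto intro!: finsum_closed)
  also have "\<dots> = (\<Oplus>j\<in>J. f x j) \<oplus> (\<Oplus>j\<in>J. \<Oplus>i\<in>I. f i j)"
    using insert by simp
  also have "\<dots> = (\<Oplus>j\<in>J. f x j \<oplus> (\<Oplus>i\<in>I. f i j))"
    using insert by (intro finsum_addf[symmetric]) (auto intro!: finsum_closed)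
  also have "\<dots> = (\<Oplus>j\<in>J. \<Oplus>i\<in>insert x I. f i j)"
    using insert by (intro finsum_cong') (auto intro!: finsum_closed)
  finally show ?case .
qed (simp add: finsum_zero)

lemma (in abelian_group) minus_eq_zero_iff:
  assumes "a \<in> carrier G" "b \<in> carrier G"
  shows "a \<ominus> b = \<zero> \<longleftrightarrow> a = b"
proof
  assume "a \<ominus> b = \<zero>"
  then have "\<ominus> (\<ominus> b) = a"
    using assms by (intro minus_equality) (simp_all add: minus_eq)
  then show "a = b"
    using assms by simp
qed (use assms in \<open>simp add: minus_eq r_neg\<close>)

locale matrices = field K for K (structure) +
  fixes V :: "'v set"
  assumes finite_index: "finite V"
begin

abbreviation M where "M \<equiv> mat_ring K V"

lemma mat_closed: "X \<in> carrier M \<Longrightarrow> X i j \<in> carrier K"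
  unfolding mat_ring_def by simp

lemma mat_outside: "X \<in> carrier M \<Longrightarrow> i \<notin> V \<or> j \<notin> V \<Longrightarrow> X i j = \<zero>"
  unfolding mat_ring_def partial_object.simps mem_Collect_eq by blast

lemma mat_carrierI:
  "(\<And>i j. X i j \<in> carrier K) \<Longrightarrow> (\<And>i j. i \<notin> V \<or> j \<notin> V \<Longrightarrow> X i j = \<zero>) \<Longrightarrow> X \<in> carrier M"
  unfolding mat_ring_def partial_object.simps mem_Collect_eq by blast

lemma mat_mult: "(X \<otimes>\<^bsub>M\<^esub> Y) i j = (\<Oplus>k\<in>V. X i k \<otimes> Y k j)"
  by (simp add: mat_ring_def)

lemma mat_add: "(X \<oplus>\<^bsub>M\<^esub> Y) i j = X i j \<oplus> Y i j"
  by (simp add: mat_ring_def)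

lemma mat_zero: "\<zero>\<^bsub>M\<^esub> i j = \<zero>"
  by (simp add: mat_ring_def)

lemma mat_one: "\<one>\<^bsub>M\<^esub> i j = (if i = j \<and> i \<in> V then \<one> else \<zero>)"
  by (simp add: mat_ring_def)

lemma finsum_closed': "(\<And>k. k \<in> A \<Longrightarrow> f k \<in> carrier K) \<Longrightarrow> (\<Oplus>k\<in>A. f k) \<in> carrier K"
  by (rule finsum_closed) auto

lemma finsum_zero': "(\<And>k. k \<in> A \<Longrightarrow> f k = \<zero>) \<Longrightarrow> (\<Oplus>k\<in>A. f k) = \<zero>"
  by (rule add.finprod_one_eqI) 

lemma finsum_delta:
  assumes "finite A" "i \<in> A" "f i \<in> carrier K" "\<And>k. k \<in> A \<Longrightarrow> k \<noteq> i \<Longrightarrow> f k = \<zero>"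
  shows "(\<Oplus>k\<in>A. f k) = f i"
proof -
  have "(\<Oplus>k\<in>A. f k) = (\<Oplus>k\<in>insert i (A - {i}). f k)"
    using assms(2) by (simp add: insert_absorb)
  also have "\<dots> = f i \<oplus> (\<Oplus>k\<in>A - {i}. f k)"
    using assms by (intro finsum_insert) auto
  also have "(\<Oplus>k\<in>A - {i}. f k) = \<zero>"
    using assms by (intro finsum_zero') auto
  finally show ?thesis using assms by simp
qed

lemma mat_mult_closed:
  assumes "X \<in> carrier M" "Y \<in> carrier M"
  shows "X \<otimes>\<^bsub>M\<^esub> Y \<in> carrier M"
proof (rule mat_carrierI)
  show "(X \<otimes>\<^bsub>M\<^esub> Y) i j \<in> carrier K" for i j
    using assms by (auto simp: mat_closed mat_mult intro!: finsum_closed')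
  show "(X \<otimes>\<^bsub>M\<^esub> Y) i j = \<zero>" if "i \<notin> V \<or> j \<notin> V" for i j
    unfolding mat_mult
  proof (rule finsum_zero')
    fix k
    show "X i k \<otimes> Y k j = \<zero>"
      using that assms mat_outside[OF assms(1), of i k] mat_outside[OF assms(2), of k j] by (auto simp: mat_closed)
  qed
qed

lemma mat_mult_assoc:
  assumes "X \<in> carrier M" "Y \<in> carrier M" "Z \<in> carrier M"
  shows "X \<otimes>\<^bsub>M\<^esub> Y \<otimes>\<^bsub>M\<^esub> Z = X \<otimes>\<^bsub>M\<^esub> (Y \<otimes>\<^bsub>M\<^esub> Z)"
proof (intro ext)
  fix i j
  have "(X \<otimes>\<^bsub>M\<^esub> Y \<otimes>\<^bsub>M\<^esub> Z) i j = (\<Oplus>k\<in>V. \<Oplus>l\<in>V. X i l \<otimes> Y l k \<otimes> Z k j)"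
    unfolding mat_mult using assms by (intro finsum_cong') (auto simp: mat_closed finsum_ldistr finite_index intro!: finsum_closed')
  also have "\<dots> = (\<Oplus>l\<in>V. \<Oplus>k\<in>V. X i l \<otimes> Y l k \<otimes> Z k j)"
    using assms finite_index by (intro finsum_swap) (auto simp: mat_closed)
  also have "\<dots> = (X \<otimes>\<^bsub>M\<^esub> (Y \<otimes>\<^bsub>M\<^esub> Z)) i j"
    unfolding mat_mult using assms
    by (intro finsum_cong') (auto simp: mat_closed finsum_rdistr finite_index m_assoc intro!: finsum_closed')
  finally show "(X \<otimes>\<^bsub>M\<^esub> Y \<otimes>\<^bsub>M\<^esub> Z) i j = (X \<otimes>\<^bsub>M\<^esub> (Y \<otimes>\<^bsub>M\<^esub> Z)) i j" .
qed

lemma mat_one_closed: "\<one>\<^bsub>M\<^esub> \<in> carrier M"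
  by (rule mat_carrierI) (auto simp: mat_closed mat_one)

lemma mat_l_one: assumes "X \<in> carrier M" shows "\<one>\<^bsub>M\<^esub> \<otimes>\<^bsub>M\<^esub> X = X"
proof (intro ext)
  fix i j
  show "(\<one>\<^bsub>M\<^esub> \<otimes>\<^bsub>M\<^esub> X) i j = X i j"
  proof (cases "i \<in> V")
    case True
    then show ?thesis unfolding mat_mult using assms finite_index
      by (subst finsum_delta[where i = i]) (auto simp: mat_closed mat_one)
  next
    case False
    then show ?thesis unfolding mat_mult using assms mat_outside[OF assms]
      by (subst finsum_zero') (auto simp: mat_closed mat_one)
  qed
qed

lemma mat_r_one: assumes "X \<in> carrier M" shows "X \<otimes>\<^bsub>M\<^esub> \<one>\<^bsub>M\<^esub> = X"
proof (intro ext)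
  fix i j
  show "(X \<otimes>\<^bsub>M\<^esub> \<one>\<^bsub>M\<^esub>) i j = X i j"
  proof (cases "j \<in> V")
    case True
    then show ?thesis unfolding mat_mult using assms finite_index
      by (subst finsum_delta[where i = j]) (auto simp: mat_closed mat_one)
  next
    case False
    then show ?thesis unfolding mat_mult using assms mat_outside[OF assms]
      by (subst finsum_zero') (auto simp: mat_closed mat_one)
  qed
qed

lemma ring_mat_ring: "ring M"
proof (rule ringI)
  show "abelian_group M"
  proof (rule abelian_groupI)
    fix X assume X: "X \<in> carrier M"
    have "(\<lambda>i j. \<ominus> X i j) \<in> carrier M" 
      using X mat_outside[OF X] by (intro mat_carrierI) (auto simp: mat_closed)
    moreover have "(\<lambda>i j. \<ominus> X i j) \<oplus>\<^bsub>M\<^esub> X = \<zero>\<^bsub>M\<^esub>"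
      using X by (auto simp: mat_closed fun_eq_iff mat_add mat_zero l_neg)
    ultimately show "\<exists>Y\<in>carrier M. Y \<oplus>\<^bsub>M\<^esub> X = \<zero>\<^bsub>M\<^esub>" by blast
    show "\<zero>\<^bsub>M\<^esub> \<oplus>\<^bsub>M\<^esub> X = X"
      using X by (simp_all add: mat_closed fun_eq_iff mat_add mat_zero)
  next
    fix X Y assume "X \<in> carrier M" "Y \<in> carrier M"
    then show "X \<oplus>\<^bsub>M\<^esub> Y \<in> carrier M" "X \<oplus>\<^bsub>M\<^esub> Y = Y \<oplus>\<^bsub>M\<^esub> X"
      by (auto intro!: mat_carrierI simp: mat_closed fun_eq_iff mat_add mat_outside a_comm)
  next
    fix X Y Z assume "X \<in> carrier M" "Y \<in> carrier M" "Z \<in> carrier M"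
    then show "X \<oplus>\<^bsub>M\<^esub> Y \<oplus>\<^bsub>M\<^esub> Z = X \<oplus>\<^bsub>M\<^esub> (Y \<oplus>\<^bsub>M\<^esub> Z)"
      by (simp add: mat_closed fun_eq_iff mat_add a_assoc)
  qed (auto simp: mat_closed mat_zero intro!: mat_carrierI)
  show "monoid M"
    by (rule monoidI) (auto simp: mat_closed mat_mult_closed mat_mult_assoc mat_one_closed mat_l_one mat_r_one)
next
  fix X Y Z assume "X \<in> carrier M" "Y \<in> carrier M" "Z \<in> carrier M"
  then show "(X \<oplus>\<^bsub>M\<^esub> Y) \<otimes>\<^bsub>M\<^esub> Z = X \<otimes>\<^bsub>M\<^esub> Z \<oplus>\<^bsub>M\<^esub> Y \<otimes>\<^bsub>M\<^esub> Z"
    by (auto simp: mat_closed fun_eq_iff mat_add mat_mult l_distr finsum_addf Pi_def)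
next
  fix X Y Z assume "X \<in> carrier M" "Y \<in> carrier M" "Z \<in> carrier M"
  then show "Z \<otimes>\<^bsub>M\<^esub> (X \<oplus>\<^bsub>M\<^esub> Y) = Z \<otimes>\<^bsub>M\<^esub> X \<oplus>\<^bsub>M\<^esub> Z \<otimes>\<^bsub>M\<^esub> Y"
    by (auto simp: mat_closed fun_eq_iff mat_add mat_mult r_distr finsum_addf Pi_def)
qed

sublocale mat: ring M
  by (rule ring_mat_ring)

lemma mat_a_inv: assumes "X \<in> carrier M" shows "(\<ominus>\<^bsub>M\<^esub> X) i j = \<ominus> X i j"
proof -
  have "(\<ominus>\<^bsub>M\<^esub> X \<oplus>\<^bsub>M\<^esub> X) i j = \<zero>"
    using mat.l_neg[OF assms] by (simp add: mat_zero)
  then show ?thesis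
    using assms by (intro minus_equality[symmetric]) (auto simp: mat_closed mat_add)
qed

lemma mat_minus: "X \<in> carrier M \<Longrightarrow> Y \<in> carrier M \<Longrightarrow> (X \<ominus>\<^bsub>M\<^esub> Y) i j = X i j \<ominus> Y i j"
  by (simp add: a_minus_def mat_add mat_a_inv)

lemma finite_mat_carrier:
  assumes "finite (carrier K)"
  shows "finite (carrier M)"
proof -
  let ?F = "{f. \<forall>p. (p \<in> V \<times> V \<longrightarrow> f p \<in> carrier K) \<and> (p \<notin> V \<times> V \<longrightarrow> f p = \<zero>)}"
  have "carrier M \<subseteq> curry ` ?F"
  proof
    fix X assume X: "X \<in> carrier M"
    have "case_prod X \<in> ?F"
    proof (intro CollectI allI conjI impI)
      fix p :: "'v \<times> 'v"
      obtain i j where [simp]: "p = (i, j)" by (cases p)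
      show "case_prod X p \<in> carrier K"
        by (simp add: mat_closed[OF X])
      show "case_prod X p = \<zero>" if "p \<notin> V \<times> V"
        using mat_outside[OF X, of i j] that by auto
    qed
    then have "curry (case_prod X) \<in> curry ` ?F"
      by (rule imageI)
    then show "X \<in> curry ` ?F"
      by (simp only: curry_case_prod)
  qed
  moreover have "finite ?F"
    by (rule finite_set_of_finite_funs[OF finite_cartesian_product[OF finite_index finite_index] assms])
  then have "finite (curry ` ?F)"
    by (rule finite_imageI)
  ultimately show ?thesis
    by (rule finite_subset)
qed

definition mat_trace where "mat_trace X = (\<Oplus>i\<in>V. X i i)"

lemma mat_trace_closed: "X \<in> carrier M \<Longrightarrow> mat_trace X \<in> carrier K"
  by (auto simp: mat_closed mat_trace_def intro!: finsum_closed')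

lemma mat_trace_add:
  "X \<in> carrier M \<Longrightarrow> Y \<in> carrier M \<Longrightarrow> mat_trace (X \<oplus>\<^bsub>M\<^esub> Y) = mat_trace X \<oplus> mat_trace Y"
  by (simp add: mat_closed mat_trace_def mat_add finsum_addf Pi_def)

lemma mat_trace_cyclic:
  assumes "X \<in> carrier M" "Y \<in> carrier M"
  shows "mat_trace (X \<otimes>\<^bsub>M\<^esub> Y) = mat_trace (Y \<otimes>\<^bsub>M\<^esub> X)"
proof -
  have "mat_trace (X \<otimes>\<^bsub>M\<^esub> Y) = (\<Oplus>k\<in>V. \<Oplus>i\<in>V. X i k \<otimes> Y k i)"
    unfolding mat_trace_def mat_mult using assms finite_index by (intro finsum_swap) (auto simp: mat_closed)
  also have "\<dots> = mat_trace (Y \<otimes>\<^bsub>M\<^esub> X)"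
    unfolding mat_trace_def mat_mult using assms
    by (intro finsum_cong') (auto simp: mat_closed m_comm intro!: finsum_closed' finsum_cong')
  finally show ?thesis .
qed

end

section \<open>Pattern groups\<close>

text \<open>A \<open>group_action\<close> takes values in the extensional bijections of
  \<open>E\<close>, while the actions used here are functions on a whole type. Restricting them to
  \<open>E\<close> changes neither orbits nor fixed points. Counting pairs instead of summing over
  the group allows later bijections to alter both components at once.\<close>

lemma (in group) burnside_pairs:
  assumes fin: "finite (carrier G)" "finite E"
    and closed: "\<And>g x. g \<in> carrier G \<Longrightarrow> x \<in> E \<Longrightarrow> \<phi> g x \<in> E"
    and mult: "\<And>g h x. g \<in> carrier G \<Longrightarrow> h \<in> carrier G \<Longrightarrow> x \<in> E \<Longrightarrow> \<phi> (g \<otimes> h) x = \<phi> g (\<phi> h x)"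
    and one: "\<And>x. x \<in> E \<Longrightarrow> \<phi> \<one> x = x"
  shows "card (orbits G E \<phi>) * card (carrier G) =
    card {(g, x). g \<in> carrier G \<and> x \<in> E \<and> \<phi> g x = x}"
proof -
  let ?\<psi> = "\<lambda>g. restrict (\<phi> g) E"
  have bij: "?\<psi> g \<in> Bij E" if g: "g \<in> carrier G" for g
  proof -
    have "bij_betw (\<phi> g) E E"
    proof (rule bij_betw_byWitness[where f' = "\<phi> (inv g)"])
      show "\<forall>x\<in>E. \<phi> (inv g) (\<phi> g x) = x" "\<forall>x\<in>E. \<phi> g (\<phi> (inv g) x) = x"
        using g by (auto simp: mult[symmetric] one)
    qed (use g closed in auto)
    then show ?thesis
      by (auto simp: Bij_def bij_betw_def inj_on_def)
  qed
  have "?\<psi> \<in> hom G (BijGroup E)"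
    by (rule homI) (use bij closed mult in \<open>auto simp: BijGroup_def compose_def fun_eq_iff\<close>)
  then interpret group_action G E ?\<psi>
    by (simp add: group_action_def group_hom_def group_hom_axioms_def group_BijGroup is_group)
  have orb: "orbits G E ?\<psi> = orbits G E \<phi>"
    by (auto simp: orbits_def orbit_def)
  have inv: "invariants E ?\<psi> g = {x \<in> E. \<phi> g x = x}" for g
    by (auto simp: invariants_def)
  have "card (orbits G E \<phi>) * card (carrier G) = (\<Sum>g\<in>carrier G. card {x \<in> E. \<phi> g x = x})"
    using burnside[OF fin] by (simp add: orb inv order_def)
  also have "\<dots> = card (SIGMA g:carrier G. {x \<in> E. \<phi> g x = x})"
    using fin by (subst card_SigmaI) auto
  also have "(SIGMA g:carrier G. {x \<in> E. \<phi> g x = x}) =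
      {(g, x). g \<in> carrier G \<and> x \<in> E \<and> \<phi> g x = x}"
    by auto
  finally show ?thesis .
qed

section \<open>Finite orders and the strictly triangular matrices over them\<close>

locale finite_order =
  fixes P :: "'v rel"
  assumes finite_poset: "finite_poset P"
begin

lemma less_irrefl: "\<not> less_in P i i"
  by (simp add: less_in_def)

lemma less_imp_le: "less_in P i j \<Longrightarrow> (i, j) \<in> P"
  by (simp add: less_in_def)

lemma le_refl: "i \<in> Field P \<Longrightarrow> (i, i) \<in> P"
  using finite_poset by (simp add: finite_poset_def order_on_defs refl_on_def)

lemma le_trans: "(i, j) \<in> P \<Longrightarrow> (j, k) \<in> P \<Longrightarrow> (i, k) \<in> P"
  using finite_poset by (auto simp: finite_poset_def order_on_defs elim: transE)

lemma le_antisym: "(i, j) \<in> P \<Longrightarrow> (j, i) \<in> P \<Longrightarrow> i = j"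
  using finite_poset by (auto simp: finite_poset_def order_on_defs antisym_def)

lemma less_le_trans: "less_in P i j \<Longrightarrow> (j, k) \<in> P \<Longrightarrow> less_in P i k"
  unfolding less_in_def using le_trans le_antisym by blast

lemma le_less_trans: "(i, j) \<in> P \<Longrightarrow> less_in P j k \<Longrightarrow> less_in P i k"
  unfolding less_in_def using le_trans le_antisym by blast

lemma less_trans: "less_in P i j \<Longrightarrow> less_in P j k \<Longrightarrow> less_in P i k"
  by (blast intro: less_le_trans less_imp_le)

lemma less_Field: "less_in P i j \<Longrightarrow> i \<in> Field P \<and> j \<in> Field P"
  by (auto simp: less_in_def Field_def)

lemma finite_Field: "finite (Field P)"
  using finite_poset by (simp add: finite_poset_def)

end

locale pattern_matrices = field K + finite_order P for K (structure) and P :: "'v rel" +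
  assumes finite_field: "finite (carrier K)"

sublocale pattern_matrices \<subseteq> matrices K "Field P"
  by unfold_locales (rule finite_Field)

context pattern_matrices
begin

abbreviation N where "N \<equiv> pattern_algebra K P"
abbreviation U where "U \<equiv> pattern_group K P"

lemma pattern_carrier: "X \<in> N \<Longrightarrow> X \<in> carrier M"
  unfolding pattern_algebra_def by blast

lemma pattern_zero: "X \<in> N \<Longrightarrow> \<not> less_in P i j \<Longrightarrow> X i j = \<zero>"
  unfolding pattern_algebra_def by blast

lemma patternI: "X \<in> carrier M \<Longrightarrow> (\<And>i j. \<not> less_in P i j \<Longrightarrow> X i j = \<zero>) \<Longrightarrow> X \<in> N"
  unfolding pattern_algebra_def by blast

lemma finite_pattern: "finite N"
  by (rule finite_subset[OF _ finite_mat_carrier[OF finite_field]]) (use pattern_carrier in blast)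

lemma pattern_add: assumes "X \<in> N" "Y \<in> N" shows "X \<oplus>\<^bsub>M\<^esub> Y \<in> N"
  by (rule patternI) (simp_all add: assms pattern_carrier mat_add pattern_zero)

lemma pattern_minus: assumes "X \<in> N" "Y \<in> N" shows "X \<ominus>\<^bsub>M\<^esub> Y \<in> N"
  by (rule patternI) (simp_all add: assms pattern_carrier mat_minus pattern_zero minus_eq)

lemma pattern_mult: assumes "X \<in> N" "Y \<in> N" shows "X \<otimes>\<^bsub>M\<^esub> Y \<in> N"
proof (rule patternI)
  fix i j assume "\<not> less_in P i j"
  show "(X \<otimes>\<^bsub>M\<^esub> Y) i j = \<zero>"
    unfolding mat_mult
  proof (rule finsum_zero')
    fix k
    have "\<not> less_in P i k \<or> \<not> less_in P k j"
      using \<open>\<not> less_in P i j\<close> less_trans by blast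
    then show "X i k \<otimes> Y k j = \<zero>"
      using pattern_zero[OF assms(1), of i k] pattern_zero[OF assms(2), of k j]
        mat_closed[OF pattern_carrier[OF assms(1)], of i k]
        mat_closed[OF pattern_carrier[OF assms(2)], of k j] by auto
  qed
qed (simp add: assms pattern_carrier)

lemma pattern_group_carrier: "g \<in> carrier U \<longleftrightarrow> (\<exists>X\<in>N. g = \<one>\<^bsub>M\<^esub> \<oplus>\<^bsub>M\<^esub> X)"
  unfolding pattern_group_def by auto

lemma pattern_group_one_add: "X \<in> N \<Longrightarrow> \<one>\<^bsub>M\<^esub> \<oplus>\<^bsub>M\<^esub> X \<in> carrier U"
  unfolding pattern_group_carrier by blast

lemma pattern_group_one: "\<one>\<^bsub>U\<^esub> = \<one>\<^bsub>M\<^esub>"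
  by (simp add: pattern_group_def)

lemma pattern_group_mult: "g \<otimes>\<^bsub>U\<^esub> h = g \<otimes>\<^bsub>M\<^esub> h"
  by (simp add: pattern_group_def)

lemma pattern_group_mat: "g \<in> carrier U \<Longrightarrow> g \<in> carrier M"
  by (auto simp: pattern_group_carrier pattern_carrier)

lemma finite_pattern_group: "finite (carrier U)"
  by (rule finite_subset[OF _ finite_mat_carrier[OF finite_field]]) (use pattern_group_mat in blast)

text \<open>The equation expresses column \<open>j\<close> of \<open>Z\<close> through the columns
  of elements strictly below \<open>j\<close>, so the columns vanish one after another, by induction
  on the number of elements below \<open>j\<close>.\<close>

lemma right_regular:
  assumes X: "X \<in> N" and Z: "Z \<in> carrier M" and "Z \<otimes>\<^bsub>M\<^esub> (\<one>\<^bsub>M\<^esub> \<oplus>\<^bsub>M\<^esub> X) = \<zero>\<^bsub>M\<^esub>"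
  shows "Z = \<zero>\<^bsub>M\<^esub>"
proof -
  have "Z \<oplus>\<^bsub>M\<^esub> Z \<otimes>\<^bsub>M\<^esub> X = \<zero>\<^bsub>M\<^esub>"
    using assms by (simp add: mat.r_distr pattern_carrier)
  then have "(Z \<oplus>\<^bsub>M\<^esub> Z \<otimes>\<^bsub>M\<^esub> X) i j = \<zero>\<^bsub>M\<^esub> i j" for i j
    by (simp only:)
  then have eq: "Z i j \<oplus> (\<Oplus>k\<in>Field P. Z i k \<otimes> X k j) = \<zero>" for i j
    by (simp only: mat_add mat_mult mat_zero)
  have "Z i j = \<zero>" for i j
  proof (induction "card {k. less_in P k j}" arbitrary: j rule: less_induct)
    case less
    have "(\<Oplus>k\<in>Field P. Z i k \<otimes> X k j) = \<zero>"
    proof (rule finsum_zero')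
      fix k
      show "Z i k \<otimes> X k j = \<zero>"
      proof (cases "less_in P k j")
        case True
        then have "{l. less_in P l k} \<subset> {l. less_in P l j}"
          using less_trans less_irrefl by blast
        moreover have "finite {l. less_in P l j}"
          by (rule finite_subset[OF _ finite_index]) (use less_Field in blast)
        ultimately have "Z i k = \<zero>"
          by (intro less) (rule psubset_card_mono)
        then show ?thesis
          by (simp add: mat_closed pattern_carrier X)
      next
        case False
        then show ?thesis
          by (simp add: mat_closed pattern_zero X Z)
      qed
    qed
    then show ?case
      using eq[of i j] mat_closed[OF Z, of i j] by simp
  qed
  then show ?thesis
    by (intro ext) (simp add: mat_zero)
qed

lemma pattern_group_mult_closed:
  assumes "g \<in> carrier U" "h \<in> carrier U"
  shows "g \<otimes>\<^bsub>M\<^esub> h \<in> carrier U"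
proof -
  obtain X Y where X: "X \<in> N" "g = \<one>\<^bsub>M\<^esub> \<oplus>\<^bsub>M\<^esub> X" and Y: "Y \<in> N" "h = \<one>\<^bsub>M\<^esub> \<oplus>\<^bsub>M\<^esub> Y"
    using assms by (auto simp: pattern_group_carrier)
  have [simp]: "X \<in> carrier M" "Y \<in> carrier M"
    using X Y by (auto intro: pattern_carrier)
  have "g \<otimes>\<^bsub>M\<^esub> h = (\<one>\<^bsub>M\<^esub> \<oplus>\<^bsub>M\<^esub> X) \<oplus>\<^bsub>M\<^esub> (Y \<oplus>\<^bsub>M\<^esub> X \<otimes>\<^bsub>M\<^esub> Y)"
    unfolding X(2) Y(2) by (simp add: mat.l_distr mat.r_distr)
  also have "\<dots> = \<one>\<^bsub>M\<^esub> \<oplus>\<^bsub>M\<^esub> (X \<oplus>\<^bsub>M\<^esub> (Y \<oplus>\<^bsub>M\<^esub> X \<otimes>\<^bsub>M\<^esub> Y))"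
    by (intro mat.a_assoc) simp_all
  finally show ?thesis
    using X(1) Y(1) by (simp add: pattern_group_one_add pattern_add pattern_mult)
qed

text \<open>Inverses come from finiteness: right multiplication by \<open>g\<close> is injective by
  \<open>right_regular\<close>, hence a permutation of the carrier, and so it attains the
  identity.\<close>

lemma group_pattern_group: "group U"
proof (rule groupI)
  show one: "\<one>\<^bsub>U\<^esub> \<in> carrier U"
    unfolding pattern_group_carrier
    by (rule bexI[of _ "\<zero>\<^bsub>M\<^esub>"]) (auto simp: pattern_group_one mat_zero intro: patternI)
  fix g assume g: "g \<in> carrier U"
  then obtain X where X: "X \<in> N" "g = \<one>\<^bsub>M\<^esub> \<oplus>\<^bsub>M\<^esub> X"
    by (auto simp: pattern_group_carrier)
  have "inj_on (\<lambda>h. h \<otimes>\<^bsub>M\<^esub> g) (carrier U)"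
  proof (rule inj_onI)
    fix h h' assume h: "h \<in> carrier U" "h' \<in> carrier U" and "h \<otimes>\<^bsub>M\<^esub> g = h' \<otimes>\<^bsub>M\<^esub> g"
    then have "(h \<ominus>\<^bsub>M\<^esub> h') \<otimes>\<^bsub>M\<^esub> g = \<zero>\<^bsub>M\<^esub>"
      using g by (simp add: mat.l_distr mat.l_minus a_minus_def mat.r_neg pattern_group_mat)
    then have "(h \<ominus>\<^bsub>M\<^esub> h') \<otimes>\<^bsub>M\<^esub> (\<one>\<^bsub>M\<^esub> \<oplus>\<^bsub>M\<^esub> X) = \<zero>\<^bsub>M\<^esub>"
      by (simp only: X(2))
    moreover have "h \<ominus>\<^bsub>M\<^esub> h' \<in> carrier M"
      using h by (simp add: pattern_group_mat)
    ultimately have "h \<ominus>\<^bsub>M\<^esub> h' = \<zero>\<^bsub>M\<^esub>"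
      by (metis right_regular[OF X(1)])
    then show "h = h'"
      using h by (simp add: mat.minus_eq_zero_iff pattern_group_mat)
  qed
  moreover have "(\<lambda>h. h \<otimes>\<^bsub>M\<^esub> g) ` carrier U \<subseteq> carrier U"
    using g pattern_group_mult_closed by blast
  ultimately have "(\<lambda>h. h \<otimes>\<^bsub>M\<^esub> g) ` carrier U = carrier U"
    by (intro endo_inj_surj finite_pattern_group)
  then show "\<exists>h\<in>carrier U. h \<otimes>\<^bsub>U\<^esub> g = \<one>\<^bsub>U\<^esub>"
    using one by (metis (no_types, lifting) imageE pattern_group_mult)
qed (simp_all add: pattern_group_mult pattern_group_mult_closed pattern_group_mat
       pattern_group_one mat.m_assoc)

sublocale gp: group U
  by (rule group_pattern_group)

lemma pattern_group_inv:
  assumes "g \<in> carrier U"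
  shows "inv\<^bsub>U\<^esub> g \<in> carrier M" "g \<otimes>\<^bsub>M\<^esub> inv\<^bsub>U\<^esub> g = \<one>\<^bsub>M\<^esub>" "inv\<^bsub>U\<^esub> g \<otimes>\<^bsub>M\<^esub> g = \<one>\<^bsub>M\<^esub>"
  using assms gp.r_inv gp.l_inv
  by (simp_all add: pattern_group_mat pattern_group_mult pattern_group_one)

lemma pattern_group_entry:
  assumes "g \<in> carrier U" "(i, k) \<notin> P"
  shows "g i k = \<zero>"
proof -
  obtain X where X: "X \<in> N" "g = \<one>\<^bsub>M\<^esub> \<oplus>\<^bsub>M\<^esub> X"
    using assms(1) by (auto simp: pattern_group_carrier)
  moreover have "\<not> less_in P i k" "\<not> (i = k \<and> i \<in> Field P)"
    using assms(2) le_refl less_imp_le by auto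
  ultimately show ?thesis
    by (simp add: mat_add mat_one pattern_zero)
qed

lemma mat_one_add_inj: "X \<in> carrier M \<Longrightarrow> Y \<in> carrier M \<Longrightarrow> \<one>\<^bsub>M\<^esub> \<oplus>\<^bsub>M\<^esub> X = \<one>\<^bsub>M\<^esub> \<oplus>\<^bsub>M\<^esub> Y \<longleftrightarrow> X = Y"
  by (metis mat.r_neg1 mat.one_closed)

lemma bij_pattern_group: "bij_betw (\<lambda>X. \<one>\<^bsub>M\<^esub> \<oplus>\<^bsub>M\<^esub> X) N (carrier U)"
  unfolding bij_betw_def
  by (auto simp: inj_on_def pattern_group_carrier pattern_carrier mat_one_add_inj)

text \<open>The identity contributes \<open>Y i j\<close> to both products. The claim is made for
  single entries because a co-adjoint fixed point requires agreement only at some positions.\<close>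

lemma commute_one_add:
  assumes "X \<in> carrier M" "Y \<in> carrier M"
  shows "((\<one>\<^bsub>M\<^esub> \<oplus>\<^bsub>M\<^esub> X) \<otimes>\<^bsub>M\<^esub> Y) i j = (Y \<otimes>\<^bsub>M\<^esub> (\<one>\<^bsub>M\<^esub> \<oplus>\<^bsub>M\<^esub> X)) i j \<longleftrightarrow> (X \<otimes>\<^bsub>M\<^esub> Y) i j = (Y \<otimes>\<^bsub>M\<^esub> X) i j"
proof -
  have "((\<one>\<^bsub>M\<^esub> \<oplus>\<^bsub>M\<^esub> X) \<otimes>\<^bsub>M\<^esub> Y) i j = Y i j \<oplus> (X \<otimes>\<^bsub>M\<^esub> Y) i j"
    using assms by (simp add: mat.l_distr mat_add)
  moreover have "(Y \<otimes>\<^bsub>M\<^esub> (\<one>\<^bsub>M\<^esub> \<oplus>\<^bsub>M\<^esub> X)) i j = Y i j \<oplus> (Y \<otimes>\<^bsub>M\<^esub> X) i j"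
    using assms by (simp add: mat.r_distr mat_add)
  ultimately show ?thesis
    using assms by (simp add: mat_closed)
qed

text \<open>Burnside's lemma for conjugation: \<open>g\<close> fixes \<open>h\<close> exactly when
  the two commute, and dropping the identity summand from both factors does not affect
  commuting.\<close>

lemma poset_classes_pairs:
  "poset_classes K P * card N = card {(X, Y). X \<in> N \<and> Y \<in> N \<and> X \<otimes>\<^bsub>M\<^esub> Y = Y \<otimes>\<^bsub>M\<^esub> X}"
proof -
  let ?\<phi> = "\<lambda>g. \<lambda>h\<in>carrier U. g \<otimes>\<^bsub>U\<^esub> h \<otimes>\<^bsub>U\<^esub> inv\<^bsub>U\<^esub> g"
  have "card (orbits U (carrier U) ?\<phi>) * card (carrier U) =
      card {(g, h). g \<in> carrier U \<and> h \<in> carrier U \<and> ?\<phi> g h = h}"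
    by (rule gp.burnside_pairs)
      (simp_all add: finite_pattern_group gp.inv_mult_group gp.m_assoc)
  also have "{(g, h). g \<in> carrier U \<and> h \<in> carrier U \<and> ?\<phi> g h = h} =
      {(g, h). g \<in> carrier U \<and> h \<in> carrier U \<and> g \<otimes>\<^bsub>U\<^esub> h = h \<otimes>\<^bsub>U\<^esub> g}"
    using gp.inv_solve_right' by auto
  also have "\<dots> = map_prod (\<lambda>X. \<one>\<^bsub>M\<^esub> \<oplus>\<^bsub>M\<^esub> X) (\<lambda>X. \<one>\<^bsub>M\<^esub> \<oplus>\<^bsub>M\<^esub> X) `
      {(X, Y). X \<in> N \<and> Y \<in> N \<and> X \<otimes>\<^bsub>M\<^esub> Y = Y \<otimes>\<^bsub>M\<^esub> X}" (is "?L = ?f ` ?R")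
  proof -
    have *: "(\<one>\<^bsub>M\<^esub> \<oplus>\<^bsub>M\<^esub> X) \<otimes>\<^bsub>M\<^esub> (\<one>\<^bsub>M\<^esub> \<oplus>\<^bsub>M\<^esub> Y) = (\<one>\<^bsub>M\<^esub> \<oplus>\<^bsub>M\<^esub> Y) \<otimes>\<^bsub>M\<^esub> (\<one>\<^bsub>M\<^esub> \<oplus>\<^bsub>M\<^esub> X) \<longleftrightarrow>
        X \<otimes>\<^bsub>M\<^esub> Y = Y \<otimes>\<^bsub>M\<^esub> X" if "X \<in> N" "Y \<in> N" for X Y
    proof -
      have [simp]: "X \<in> carrier M" "Y \<in> carrier M"
        using that by (auto intro: pattern_carrier)
      have "(\<one>\<^bsub>M\<^esub> \<oplus>\<^bsub>M\<^esub> X) \<otimes>\<^bsub>M\<^esub> (\<one>\<^bsub>M\<^esub> \<oplus>\<^bsub>M\<^esub> Y) = (\<one>\<^bsub>M\<^esub> \<oplus>\<^bsub>M\<^esub> Y) \<otimes>\<^bsub>M\<^esub> (\<one>\<^bsub>M\<^esub> \<oplus>\<^bsub>M\<^esub> X) \<longleftrightarrow>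
          X \<otimes>\<^bsub>M\<^esub> (\<one>\<^bsub>M\<^esub> \<oplus>\<^bsub>M\<^esub> Y) = (\<one>\<^bsub>M\<^esub> \<oplus>\<^bsub>M\<^esub> Y) \<otimes>\<^bsub>M\<^esub> X"
        unfolding fun_eq_iff by (subst commute_one_add) auto
      also have "\<dots> \<longleftrightarrow> X \<otimes>\<^bsub>M\<^esub> Y = Y \<otimes>\<^bsub>M\<^esub> X"
        unfolding fun_eq_iff by (subst (1 2) eq_commute, subst commute_one_add) (auto simp: eq_commute)
      finally show ?thesis .
    qed
    show ?thesis
    proof
      show "?L \<subseteq> ?f ` ?R"
        using * by (fastforce simp: pattern_group_carrier pattern_group_mult)
      show "?f ` ?R \<subseteq> ?L"
        using * by (auto simp: pattern_group_one_add pattern_group_mult)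
    qed
  qed
  also have "card \<dots> = card {(X, Y). X \<in> N \<and> Y \<in> N \<and> X \<otimes>\<^bsub>M\<^esub> Y = Y \<otimes>\<^bsub>M\<^esub> X}"
    by (rule card_image) (auto simp: inj_on_def pattern_carrier mat_one_add_inj)
  finally show ?thesis
    unfolding poset_classes_def Let_def bij_betw_same_card[OF bij_pattern_group] .
qed

end

section \<open>Co-adjoint orbits of poset systems\<close>

context pattern_matrices
begin

text \<open>Closure of a set of positions under larger rows and smaller columns. This is what makes
  vanishing on \<open>S\<close> stable under multiplication by the pattern group from either side.
  All lower positions (for the space of \<open>P\<close>) and the positions of row \<open>m\<close>
  (for the space of \<open>below_poset P m\<close>) are both of this kind, so one theory serves both
  actions.\<close>

definition upward :: "('v \<Rightarrow> 'v \<Rightarrow> bool) \<Rightarrow> bool" where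
  "upward S \<longleftrightarrow> (\<forall>i j k l. S i j \<longrightarrow> (i, k) \<in> P \<longrightarrow> (l, j) \<in> P \<longrightarrow> S k l)"

text \<open>By \<open>vanishing_coset\<close> this is the additive coset of \<open>X\<close> modulo
  the matrices that vanish on \<open>S\<close>. Equality of cosets becomes equality of
  entries.\<close>

definition mat_class :: "('v \<Rightarrow> 'v \<Rightarrow> bool) \<Rightarrow> ('v \<Rightarrow> 'v \<Rightarrow> 'a) \<Rightarrow> ('v \<Rightarrow> 'v \<Rightarrow> 'a) set" where
  "mat_class S X = {Y \<in> carrier M. \<forall>i j. S i j \<longrightarrow> Y i j = X i j}"

definition class_action ::
    "('v \<Rightarrow> 'v \<Rightarrow> bool) \<Rightarrow> ('v \<Rightarrow> 'v \<Rightarrow> 'a) \<Rightarrow> ('v \<Rightarrow> 'v \<Rightarrow> 'a) set \<Rightarrow> ('v \<Rightarrow> 'v \<Rightarrow> 'a) set" where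
  "class_action S g Q = (\<Union>Z\<in>Q. mat_class S (g \<otimes>\<^bsub>M\<^esub> Z \<otimes>\<^bsub>M\<^esub> inv\<^bsub>U\<^esub> g))"

lemma mat_class_self: "X \<in> carrier M \<Longrightarrow> X \<in> mat_class S X"
  by (simp add: mat_class_def)

lemma mat_class_eq_iff:
  assumes "X \<in> carrier M" "Y \<in> carrier M"
  shows "mat_class S X = mat_class S Y \<longleftrightarrow> (\<forall>i j. S i j \<longrightarrow> X i j = Y i j)"
proof
  assume "mat_class S X = mat_class S Y"
  then have "X \<in> mat_class S Y"
    using mat_class_self[OF assms(1), of S] by (simp only:)
  then show "\<forall>i j. S i j \<longrightarrow> X i j = Y i j"
    by (simp add: mat_class_def)
qed (simp add: mat_class_def)

lemma vanish_mult_left: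
  assumes S: "upward S" "S i j" and g: "g \<in> carrier U" and Z: "Z \<in> carrier M"
    and vanish: "\<And>i j. S i j \<Longrightarrow> Z i j = \<zero>"
  shows "(g \<otimes>\<^bsub>M\<^esub> Z) i j = \<zero>"
  unfolding mat_mult
proof (rule finsum_zero')
  fix k
  show "g i k \<otimes> Z k j = \<zero>"
  \<comment> \<open>Applying \<open>upward\<close> needs \<open>(j, j) \<in> P\<close>, which holds
    only for \<open>j\<close> in the field. For other \<open>j\<close> the entry
    \<open>Z k j\<close> is zero anyway.\<close>
  proof (cases "(i, k) \<in> P \<and> j \<in> Field P")
    case True
    then have "S k j"
      using S le_refl unfolding upward_def by blast
    then show ?thesis
      by (simp add: vanish mat_closed pattern_group_mat g)
  next
    case False
    then have "g i k = \<zero> \<or> Z k j = \<zero>"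
      using pattern_group_entry[OF g] mat_outside[OF Z, of k j] by blast
    then show ?thesis
      by (auto simp: mat_closed pattern_group_mat g Z)
  qed
qed

lemma vanish_mult_right:
  assumes S: "upward S" "S i j" and g: "g \<in> carrier U" and Z: "Z \<in> carrier M"
    and vanish: "\<And>i j. S i j \<Longrightarrow> Z i j = \<zero>"
  shows "(Z \<otimes>\<^bsub>M\<^esub> g) i j = \<zero>"
  unfolding mat_mult
proof (rule finsum_zero')
  fix k
  show "Z i k \<otimes> g k j = \<zero>"
  proof (cases "(k, j) \<in> P \<and> i \<in> Field P")
    case True
    then have "S i k"
      using S le_refl unfolding upward_def by blast
    then show ?thesis
      by (simp add: vanish mat_closed pattern_group_mat g)
  next
    case False
    then have "g k j = \<zero> \<or> Z i k = \<zero>"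
      using pattern_group_entry[OF g] mat_outside[OF Z, of i k] by blast
    then show ?thesis
      by (auto simp: mat_closed pattern_group_mat g Z)
  qed
qed

lemma minus_vanish_iff:
  assumes "X \<in> carrier M" "Y \<in> carrier M"
  shows "(X \<ominus>\<^bsub>M\<^esub> Y) i j = \<zero> \<longleftrightarrow> X i j = Y i j"
  using assms by (simp add: mat_minus mat_closed minus_eq_zero_iff)

lemma class_action_closed:
  "g \<in> carrier U \<Longrightarrow> X \<in> carrier M \<Longrightarrow> g \<otimes>\<^bsub>M\<^esub> X \<otimes>\<^bsub>M\<^esub> inv\<^bsub>U\<^esub> g \<in> carrier M"
  by (simp add: pattern_group_mat)

text \<open>The union over representatives collapses to one class: two representatives differ by a
  matrix vanishing on \<open>S\<close>, and its conjugate vanishes on \<open>S\<close> too.\<close>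

lemma class_action_mat_class:
  assumes S: "upward S" and g: "g \<in> carrier U" and X: "X \<in> carrier M"
  shows "class_action S g (mat_class S X) = mat_class S (g \<otimes>\<^bsub>M\<^esub> X \<otimes>\<^bsub>M\<^esub> inv\<^bsub>U\<^esub> g)"
proof -
  let ?h = "inv\<^bsub>U\<^esub> g"
  have h: "?h \<in> carrier U" and [simp]: "g \<in> carrier M" "?h \<in> carrier M" "X \<in> carrier M"
    using g X by (simp_all add: pattern_group_mat)
  have "mat_class S (g \<otimes>\<^bsub>M\<^esub> Z \<otimes>\<^bsub>M\<^esub> ?h) = mat_class S (g \<otimes>\<^bsub>M\<^esub> X \<otimes>\<^bsub>M\<^esub> ?h)" if "Z \<in> mat_class S X" for Z
  proof -
    have [simp]: "Z \<in> carrier M" and ZX: "\<And>i j. S i j \<Longrightarrow> Z i j = X i j"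
      using that by (simp_all add: mat_class_def)
    have "(g \<otimes>\<^bsub>M\<^esub> (Z \<ominus>\<^bsub>M\<^esub> X) \<otimes>\<^bsub>M\<^esub> ?h) i j = \<zero>" if ij: "S i j" for i j
    proof (rule vanish_mult_right[OF S ij h])
      fix i j assume "S i j"
      show "(g \<otimes>\<^bsub>M\<^esub> (Z \<ominus>\<^bsub>M\<^esub> X)) i j = \<zero>"
        by (rule vanish_mult_left[OF S \<open>S i j\<close> g]) (simp_all add: minus_vanish_iff ZX)
    qed simp
    moreover have "g \<otimes>\<^bsub>M\<^esub> (Z \<ominus>\<^bsub>M\<^esub> X) \<otimes>\<^bsub>M\<^esub> ?h = g \<otimes>\<^bsub>M\<^esub> Z \<otimes>\<^bsub>M\<^esub> ?h \<ominus>\<^bsub>M\<^esub> g \<otimes>\<^bsub>M\<^esub> X \<otimes>\<^bsub>M\<^esub> ?h"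
      by (simp add: a_minus_def mat.r_distr mat.l_distr mat.r_minus mat.l_minus)
    ultimately show ?thesis
      by (simp add: mat_class_eq_iff minus_vanish_iff)
  qed
  then show ?thesis
    using mat_class_self[OF X] unfolding class_action_def by blast
qed

lemma pattern_group_inv_mult:
  "g \<in> carrier U \<Longrightarrow> h \<in> carrier U \<Longrightarrow> inv\<^bsub>U\<^esub> (g \<otimes>\<^bsub>M\<^esub> h) = inv\<^bsub>U\<^esub> h \<otimes>\<^bsub>M\<^esub> inv\<^bsub>U\<^esub> g"
  using gp.inv_mult_group by (simp only: pattern_group_mult)

lemma class_action_mult:
  assumes "upward S" "g \<in> carrier U" "h \<in> carrier U" "X \<in> carrier M"
  shows "class_action S (g \<otimes>\<^bsub>U\<^esub> h) (mat_class S X) = class_action S g (class_action S h (mat_class S X))"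
proof -
  have "g \<otimes>\<^bsub>U\<^esub> h \<otimes>\<^bsub>M\<^esub> X \<otimes>\<^bsub>M\<^esub> inv\<^bsub>U\<^esub> (g \<otimes>\<^bsub>U\<^esub> h) =
      g \<otimes>\<^bsub>M\<^esub> (h \<otimes>\<^bsub>M\<^esub> X \<otimes>\<^bsub>M\<^esub> inv\<^bsub>U\<^esub> h) \<otimes>\<^bsub>M\<^esub> inv\<^bsub>U\<^esub> g"
    using assms by (simp add: pattern_group_inv_mult pattern_group_mult mat.m_assoc pattern_group_mat)
  then show ?thesis
    using assms by (simp add: class_action_mat_class class_action_closed)
qed

lemma class_action_one:
  assumes "upward S" "X \<in> carrier M"
  shows "class_action S \<one>\<^bsub>U\<^esub> (mat_class S X) = mat_class S X"
  using assms by (simp add: class_action_mat_class) (simp add: pattern_group_one)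

lemma class_fixed_iff:
  assumes S: "upward S" and g: "g \<in> carrier U" and X: "X \<in> carrier M"
  shows "class_action S g (mat_class S X) = mat_class S X \<longleftrightarrow>
    (\<forall>i j. S i j \<longrightarrow> (g \<otimes>\<^bsub>M\<^esub> X) i j = (X \<otimes>\<^bsub>M\<^esub> g) i j)"
proof -
  let ?h = "inv\<^bsub>U\<^esub> g" and ?D = "g \<otimes>\<^bsub>M\<^esub> X \<ominus>\<^bsub>M\<^esub> X \<otimes>\<^bsub>M\<^esub> g"
  have h: "?h \<in> carrier U" and [simp]: "g \<in> carrier M" "?h \<in> carrier M" "X \<in> carrier M"
    using g X by (simp_all add: pattern_group_mat)
  have D1: "?D \<otimes>\<^bsub>M\<^esub> ?h = g \<otimes>\<^bsub>M\<^esub> X \<otimes>\<^bsub>M\<^esub> ?h \<ominus>\<^bsub>M\<^esub> X"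
    by (simp add: a_minus_def mat.l_distr mat.l_minus mat.m_assoc pattern_group_inv[OF g])
  have D2: "?D \<otimes>\<^bsub>M\<^esub> ?h \<otimes>\<^bsub>M\<^esub> g = ?D"
    by (simp add: mat.m_assoc pattern_group_inv[OF g])
  have "class_action S g (mat_class S X) = mat_class S X \<longleftrightarrow> (\<forall>i j. S i j \<longrightarrow> (?D \<otimes>\<^bsub>M\<^esub> ?h) i j = \<zero>)"
    unfolding D1 by (simp add: class_action_mat_class S g mat_class_eq_iff minus_vanish_iff)
  also have "\<dots> \<longleftrightarrow> (\<forall>i j. S i j \<longrightarrow> ?D i j = \<zero>)"
  proof safe
    fix i j assume "\<forall>i j. S i j \<longrightarrow> (?D \<otimes>\<^bsub>M\<^esub> ?h) i j = \<zero>" "S i j"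
    then show "?D i j = \<zero>"
      by (subst D2[symmetric]) (intro vanish_mult_right[OF S _ g], simp_all)
  next
    fix i j assume "\<forall>i j. S i j \<longrightarrow> ?D i j = \<zero>" "S i j"
    then show "(?D \<otimes>\<^bsub>M\<^esub> ?h) i j = \<zero>"
      by (intro vanish_mult_right[OF S _ h]) simp_all
  qed
  finally show ?thesis
    by (simp add: minus_vanish_iff)
qed

lemma class_fixed_one_add_iff:
  assumes S: "upward S" and X: "X \<in> N" and Z: "Z \<in> carrier M"
  shows "class_action S (\<one>\<^bsub>M\<^esub> \<oplus>\<^bsub>M\<^esub> X) (mat_class S Z) = mat_class S Z \<longleftrightarrow>
    (\<forall>i j. S i j \<longrightarrow> (X \<otimes>\<^bsub>M\<^esub> Z) i j = (Z \<otimes>\<^bsub>M\<^esub> X) i j)"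
  using class_fixed_iff[OF S pattern_group_one_add[OF X] Z]
    commute_one_add[OF pattern_carrier[OF X] Z] by simp

lemma vanishing_coset:
  assumes X: "X \<in> carrier M"
  shows "{Z \<in> carrier M. \<forall>i j. S i j \<longrightarrow> Z i j = \<zero>} +>\<^bsub>M\<^esub> X = mat_class S X"
proof
  show "{Z \<in> carrier M. \<forall>i j. S i j \<longrightarrow> Z i j = \<zero>} +>\<^bsub>M\<^esub> X \<subseteq> mat_class S X"
  proof
    fix Y assume "Y \<in> {Z \<in> carrier M. \<forall>i j. S i j \<longrightarrow> Z i j = \<zero>} +>\<^bsub>M\<^esub> X"
    then obtain Z where "Z \<in> carrier M" "\<forall>i j. S i j \<longrightarrow> Z i j = \<zero>" "Y = Z \<oplus>\<^bsub>M\<^esub> X"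
      by (auto simp: a_r_coset_def')
    then show "Y \<in> mat_class S X"
      using X by (simp add: mat_class_def mat_add mat_closed)
  qed
  show "mat_class S X \<subseteq> {Z \<in> carrier M. \<forall>i j. S i j \<longrightarrow> Z i j = \<zero>} +>\<^bsub>M\<^esub> X"
  proof
    fix Y assume "Y \<in> mat_class S X"
    then have Y: "Y \<in> carrier M" "\<And>i j. S i j \<Longrightarrow> Y i j = X i j"
      by (simp_all add: mat_class_def)
    then have "Y \<ominus>\<^bsub>M\<^esub> X \<in> {Z \<in> carrier M. \<forall>i j. S i j \<longrightarrow> Z i j = \<zero>}"
      using X by (simp add: minus_vanish_iff)
    moreover have "Y = (Y \<ominus>\<^bsub>M\<^esub> X) \<oplus>\<^bsub>M\<^esub> X"
      using X Y(1) by (simp add: a_minus_def mat.a_assoc mat.l_neg)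
    ultimately show "Y \<in> {Z \<in> carrier M. \<forall>i j. S i j \<longrightarrow> Z i j = \<zero>} +>\<^bsub>M\<^esub> X"
      unfolding a_r_coset_def' by blast
  qed
qed

lemma class_stabilizer_subgroup:
  assumes S: "upward S" and X: "X \<in> carrier M"
  shows "subgroup {g \<in> carrier U. class_action S g (mat_class S X) = mat_class S X} U"
proof (rule gp.subgroupI)
  fix g assume g: "g \<in> {g \<in> carrier U. class_action S g (mat_class S X) = mat_class S X}"
  then have "mat_class S X = class_action S (inv\<^bsub>U\<^esub> g \<otimes>\<^bsub>U\<^esub> g) (mat_class S X)"
    using class_action_one[OF S X] by simp
  also have "\<dots> = class_action S (inv\<^bsub>U\<^esub> g) (mat_class S X)"
    using g S X by (subst class_action_mult) auto
  finally show "inv\<^bsub>U\<^esub> g \<in> {g \<in> carrier U. class_action S g (mat_class S X) = mat_class S X}"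
    using g by simp
qed (use class_action_one[OF S X] class_action_mult[OF S _ _ X] in auto)

abbreviation lower where "lower \<equiv> \<lambda>i j. less_in P j i"

lemma upward_lower: "upward lower"
  unfolding upward_def using le_less_trans less_le_trans by blast

lemma coadj_kernel_coset: "X \<in> carrier M \<Longrightarrow> coadj_kernel K P +>\<^bsub>M\<^esub> X = mat_class lower X"
  unfolding coadj_kernel_def by (rule vanishing_coset)

lemma coadj_space_classes: "coadj_space K P = mat_class lower ` carrier M"
  unfolding coadj_space_def A_RCOSETS_def' using coadj_kernel_coset by auto

lemma coadj_action_class_action:
  assumes "g \<in> carrier U" "Q \<subseteq> carrier M"
  shows "coadj_action K P g Q = class_action lower g Q"
  unfolding coadj_action_def class_action_def Let_def
  using assms by (intro SUP_cong refl coadj_kernel_coset class_action_closed) auto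

end

section \<open>Stabilizer and fibre for a single-element antichain\<close>

locale pattern_system = pattern_matrices +
  fixes m a
  assumes system: "poset_system P m {a}"
begin

abbreviation below where "below \<equiv> \<lambda>i j. i = m \<and> less_in P j m"

abbreviation E where "E \<equiv> mat_unit K m a"

definition stab_pattern where
  "stab_pattern = {X \<in> N. \<forall>j. less_in P j m \<longrightarrow> X a j = \<zero>}"

text \<open>Canonical representatives: each class of the fibre contains exactly one of these
  matrices (\<open>fibre_image\<close>, \<open>point_fibre_inj\<close>), since all entries that the
  class does not see are set to zero.\<close>

definition point_fibre where
  "point_fibre = {Z \<in> carrier M. (\<forall>i j. \<not> less_in P j i \<longrightarrow> Z i j = \<zero>) \<and>
     (\<forall>j. less_in P j m \<longrightarrow> Z m j = E m j)}"

lemma m_max: "\<not> less_in P m y"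
  using system less_Field by (auto simp: poset_system_def max_elements_def)

lemma a_less_m: "less_in P a m"
  using system by (auto simp: poset_system_def antichains_def lower_bounds_def)

lemma a_Field: "a \<in> Field P" and m_Field: "m \<in> Field P"
  using less_Field[OF a_less_m] by auto

text \<open>Maximality of \<open>m\<close> leaves no larger row, and the elements below
  \<open>m\<close> form a down-set.\<close>

lemma upward_below: "upward below"
  unfolding upward_def
proof (intro allI impI conjI)
  fix i j k l assume "i = m \<and> less_in P j m" "(i, k) \<in> P" "(l, j) \<in> P"
  then show "k = m" "less_in P l m"
    using m_max[of k] le_less_trans by (auto simp: less_in_def)
qed

lemma Field_below: "Field (below_poset P m) = Field P"
proof -
  have "Field {(x, m) |x. less_in P x m} \<subseteq> Field P"
    unfolding Field_def[of "{(x, m) |x. less_in P x m}"] using less_Field by blast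
  moreover have "Field (Id_on (Field P)) = Field P"
    unfolding Field_def[of "Id_on (Field P)"] by auto
  ultimately show ?thesis
    unfolding below_poset_def Field_Un by blast
qed

lemma less_below: "less_in (below_poset P m) j i \<longleftrightarrow> below i j"
  by (auto simp: below_poset_def less_in_def)

lemma below_kernel_coset:
  "X \<in> carrier M \<Longrightarrow> coadj_kernel K (below_poset P m) +>\<^bsub>M\<^esub> X = mat_class below X"
  unfolding coadj_kernel_def Field_below less_below by (rule vanishing_coset)

lemma below_proj_class:
  assumes "X \<in> carrier M"
  shows "below_proj K P m (mat_class lower X) = mat_class below X"
  unfolding below_proj_def
proof (rule SUP_eq_const)
  show "mat_class lower X \<noteq> {}"
    using mat_class_self[OF assms] by blast
  fix Z assume "Z \<in> mat_class lower X"
  then have "Z \<in> carrier M" "\<And>i j. less_in P j i \<Longrightarrow> Z i j = X i j"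
    by (simp_all add: mat_class_def)
  then show "coadj_kernel K (below_poset P m) +>\<^bsub>M\<^esub> Z = mat_class below X"
    using assms by (simp add: below_kernel_coset mat_class_eq_iff)
qed

lemma E_closed: "E \<in> carrier M"
  using a_Field m_Field by (intro mat_carrierI) (auto simp: mat_unit_def)

lemma antichain_point_class: "antichain_point K P m {a} = mat_class below E"
proof -
  have "(\<Oplus>\<^bsub>M\<^esub>x\<in>{a}. mat_unit K m x) = E"
    using E_closed by (simp add: mat.finsum_insert mat.finsum_empty)
  then show ?thesis
    by (simp add: antichain_point_def Let_def below_kernel_coset E_closed)
qed

lemma coadj_action_mat_class:
  "g \<in> carrier U \<Longrightarrow> X \<in> carrier M \<Longrightarrow>
    coadj_action K P g (mat_class lower X) = mat_class lower (g \<otimes>\<^bsub>M\<^esub> X \<otimes>\<^bsub>M\<^esub> inv\<^bsub>U\<^esub> g)"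
  by (subst coadj_action_class_action)
    (auto simp: class_action_mat_class[OF upward_lower], simp add: mat_class_def)

text \<open>The induced action is a union over all preimages under the projection. Each preimage has
  a representative agreeing with \<open>X\<close> on row \<open>m\<close> below \<open>m\<close>,
  and conjugation respects this agreement, so every preimage gives the same class.\<close>

lemma below_action_class:
  assumes g: "g \<in> carrier U" and X: "X \<in> carrier M"
  shows "below_action K P m g (mat_class below X) = class_action below g (mat_class below X)"
  unfolding below_action_def
proof (rule SUP_eq_const)
  show "{L \<in> coadj_space K P. below_proj K P m L = mat_class below X} \<noteq> {}"
    using X below_proj_class[OF X] by (auto simp: coadj_space_classes)
  fix L assume "L \<in> {L \<in> coadj_space K P. below_proj K P m L = mat_class below X}"
  then obtain Z where Z: "Z \<in> carrier M" "L = mat_class lower Z" "mat_class below Z = mat_class below X"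
    by (auto simp: coadj_space_classes below_proj_class)
  have "below_proj K P m (coadj_action K P g L) = mat_class below (g \<otimes>\<^bsub>M\<^esub> Z \<otimes>\<^bsub>M\<^esub> inv\<^bsub>U\<^esub> g)"
    using g Z(1) unfolding Z(2) by (simp add: coadj_action_mat_class below_proj_class class_action_closed)
  also have "\<dots> = class_action below g (mat_class below X)"
    unfolding Z(3)[symmetric] by (rule class_action_mat_class[symmetric, OF upward_below g Z(1)])
  finally show "below_proj K P m (coadj_action K P g L) = class_action below g (mat_class below X)" .
qed

text \<open>Row \<open>m\<close> of \<open>X\<close> is zero by maximality, and left multiplication
  by \<open>E\<close> copies row \<open>a\<close> of \<open>X\<close> into row \<open>m\<close>.
  Hence the point is fixed exactly when row \<open>a\<close> vanishes at all columns below
  \<open>m\<close>, which is the condition in \<open>stab_pattern\<close>.\<close>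

lemma E_commute:
  assumes "X \<in> N"
  shows "(X \<otimes>\<^bsub>M\<^esub> E) m j = \<zero>" "(E \<otimes>\<^bsub>M\<^esub> X) m j = X a j"
proof -
  show "(X \<otimes>\<^bsub>M\<^esub> E) m j = \<zero>"
    unfolding mat_mult
    by (rule finsum_zero') (simp add: pattern_zero[OF assms m_max] mat_closed[OF E_closed])
  have "(E \<otimes>\<^bsub>M\<^esub> X) m j = E m a \<otimes> X a j"
    unfolding mat_mult
    by (rule finsum_delta)
      (use finite_index a_Field in \<open>auto simp: mat_unit_def mat_closed pattern_carrier[OF assms]\<close>)
  then show "(E \<otimes>\<^bsub>M\<^esub> X) m j = X a j"
    by (simp add: mat_unit_def mat_closed pattern_carrier[OF assms])
qed

lemma one_add_stabilizes_iff:
  assumes "X \<in> N"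
  shows "class_action below (\<one>\<^bsub>M\<^esub> \<oplus>\<^bsub>M\<^esub> X) (mat_class below E) = mat_class below E \<longleftrightarrow> X \<in> stab_pattern"
  unfolding class_fixed_one_add_iff[OF upward_below assms E_closed]
  using assms by (auto simp: E_commute[OF assms] stab_pattern_def)

lemma stabilizer_class:
  "stabilizer U (below_action K P m) (mat_class below E) =
     {g \<in> carrier U. class_action below g (mat_class below E) = mat_class below E}"
  using below_action_class[OF _ E_closed] by (auto simp: stabilizer_def)

lemma stabilizer_image:
  "stabilizer U (below_action K P m) (mat_class below E) = (\<lambda>X. \<one>\<^bsub>M\<^esub> \<oplus>\<^bsub>M\<^esub> X) ` stab_pattern"
  unfolding stabilizer_class
proof
  show "(\<lambda>X. \<one>\<^bsub>M\<^esub> \<oplus>\<^bsub>M\<^esub> X) ` stab_pattern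
      \<subseteq> {g \<in> carrier U. class_action below g (mat_class below E) = mat_class below E}"
    using one_add_stabilizes_iff pattern_group_one_add by (auto simp: stab_pattern_def)
  show "{g \<in> carrier U. class_action below g (mat_class below E) = mat_class below E}
      \<subseteq> (\<lambda>X. \<one>\<^bsub>M\<^esub> \<oplus>\<^bsub>M\<^esub> X) ` stab_pattern"
  proof
    fix g assume g: "g \<in> {g \<in> carrier U. class_action below g (mat_class below E) = mat_class below E}"
    then obtain X where X: "X \<in> N" "g = \<one>\<^bsub>M\<^esub> \<oplus>\<^bsub>M\<^esub> X"
      by (auto simp: pattern_group_carrier)
    then have "X \<in> stab_pattern"
      using g one_add_stabilizes_iff[OF X(1)] by simp
    then show "g \<in> (\<lambda>X. \<one>\<^bsub>M\<^esub> \<oplus>\<^bsub>M\<^esub> X) ` stab_pattern"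
      using X(2) by blast
  qed
qed

lemma fibre_image:
  "{L \<in> coadj_space K P. below_proj K P m L = mat_class below E} = mat_class lower ` point_fibre"
proof
  show "mat_class lower ` point_fibre \<subseteq> {L \<in> coadj_space K P. below_proj K P m L = mat_class below E}"
  proof (rule image_subsetI)
    fix Z assume "Z \<in> point_fibre"
    then have Z: "Z \<in> carrier M" "\<forall>j. less_in P j m \<longrightarrow> Z m j = E m j"
      by (simp_all add: point_fibre_def)
    then have "mat_class below Z = mat_class below E"
      by (simp add: mat_class_eq_iff E_closed)
    then show "mat_class lower Z \<in> {L \<in> coadj_space K P. below_proj K P m L = mat_class below E}"
      using Z(1) by (simp add: below_proj_class coadj_space_classes)
  qed
  show "{L \<in> coadj_space K P. below_proj K P m L = mat_class below E} \<subseteq> mat_class lower ` point_fibre"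
  proof
    fix L assume "L \<in> {L \<in> coadj_space K P. below_proj K P m L = mat_class below E}"
    then obtain Z where Z: "Z \<in> carrier M" "L = mat_class lower Z" "mat_class below Z = mat_class below E"
      by (auto simp: coadj_space_classes below_proj_class)
    \<comment> \<open>Truncation to the lower positions changes no entry that the class depends on
      and produces the canonical representative.\<close>
    let ?Z = "\<lambda>i j. if less_in P j i then Z i j else \<zero>"
    have Z': "?Z \<in> carrier M"
      using less_Field by (intro mat_carrierI) (auto simp: mat_closed[OF Z(1)])
    moreover have "Z m j = E m j" if "less_in P j m" for j
      using Z(3) that by (simp add: mat_class_eq_iff[OF Z(1) E_closed])
    ultimately have "?Z \<in> point_fibre"
      by (simp add: point_fibre_def)
    moreover have "L = mat_class lower ?Z"
      unfolding Z(2) by (subst mat_class_eq_iff[OF Z(1) Z']) simp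
    ultimately show "L \<in> mat_class lower ` point_fibre"
      by blast
  qed
qed

lemma point_fibre_inj: "inj_on (mat_class lower) point_fibre"
proof (rule inj_onI, intro ext)
  fix X Y i j
  assume XY: "X \<in> point_fibre" "Y \<in> point_fibre" "mat_class lower X = mat_class lower Y"
  then have "X \<in> carrier M" "Y \<in> carrier M" and zero: "\<not> less_in P j i \<Longrightarrow> X i j = \<zero> \<and> Y i j = \<zero>"
    by (auto simp: point_fibre_def)
  then have "less_in P j i \<Longrightarrow> X i j = Y i j"
    using XY(3) by (simp add: mat_class_eq_iff)
  then show "X i j = Y i j"
    using zero by (cases "less_in P j i") simp_all
qed

text \<open>Burnside's lemma for the stabilizer acting on the fibre, with group elements written as
  \<open>1 + X\<close> and classes replaced by their canonical representatives.\<close>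

lemma system_orbits_pairs:
  "system_orbits K P m {a} * card stab_pattern =
    card {(X, Z). X \<in> stab_pattern \<and> Z \<in> point_fibre \<and>
      (\<forall>i j. less_in P j i \<longrightarrow> (X \<otimes>\<^bsub>M\<^esub> Z) i j = (Z \<otimes>\<^bsub>M\<^esub> X) i j)}"
proof -
  define H where "H = stabilizer U (below_action K P m) (mat_class below E)"
  define F where "F = {L \<in> coadj_space K P. below_proj K P m L = mat_class below E}"
  have sub: "subgroup H U"
    unfolding H_def stabilizer_class by (rule class_stabilizer_subgroup[OF upward_below E_closed])
  then have HU: "g \<in> carrier U" if "g \<in> H" for g
    using that by (rule subgroup.mem_carrier)
  have F: "\<exists>Z\<in>carrier M. L = mat_class lower Z \<and> mat_class below Z = mat_class below E" if "L \<in> F" for L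
    using that by (auto simp: F_def coadj_space_classes below_proj_class)
  interpret H: group "U\<lparr>carrier := H\<rparr>"
    by (rule subgroup.subgroup_is_group[OF sub group_pattern_group])
  have "card (orbits (U\<lparr>carrier := H\<rparr>) F (coadj_action K P)) * card (carrier (U\<lparr>carrier := H\<rparr>)) =
      card {(g, x). g \<in> carrier (U\<lparr>carrier := H\<rparr>) \<and> x \<in> F \<and> coadj_action K P g x = x}"
  proof (rule H.burnside_pairs)
    show "finite (carrier (U\<lparr>carrier := H\<rparr>))"
      using finite_pattern_group HU by (auto intro: finite_subset)
    show "finite F"
      unfolding F_def coadj_space_classes using finite_mat_carrier[OF finite_field] by simp
    fix L assume "L \<in> F"
    then obtain Z where Z: "Z \<in> carrier M" "L = mat_class lower Z" "mat_class below Z = mat_class below E"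
      using F by blast
    show "coadj_action K P \<one>\<^bsub>U\<lparr>carrier := H\<rparr>\<^esub> L = L"
      using Z(1) unfolding Z(2) by (simp add: coadj_action_mat_class) (simp add: pattern_group_one)
    fix g assume "g \<in> carrier (U\<lparr>carrier := H\<rparr>)"
    then have g: "g \<in> H" "g \<in> carrier U"
      using HU by auto
    \<comment> \<open>The projection of the moved class is the moved projection, and
      \<open>g\<close> fixes that point, so the fibre is preserved.\<close>
    have "mat_class below (g \<otimes>\<^bsub>M\<^esub> Z \<otimes>\<^bsub>M\<^esub> inv\<^bsub>U\<^esub> g) = mat_class below E"
      using g class_action_mat_class[OF upward_below g(2) Z(1)] Z(3)
      by (simp add: H_def stabilizer_class)
    then show "coadj_action K P g L \<in> F"
      using g Z(1) unfolding Z(2) F_def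
      by (simp add: coadj_action_mat_class below_proj_class class_action_closed coadj_space_classes)
    fix h assume "h \<in> carrier (U\<lparr>carrier := H\<rparr>)"
    then have h: "h \<in> carrier U"
      using HU by auto
    show "coadj_action K P (g \<otimes>\<^bsub>U\<lparr>carrier := H\<rparr>\<^esub> h) L = coadj_action K P g (coadj_action K P h L)"
      using class_action_mult[OF upward_lower g(2) h Z(1)] g h Z(1) unfolding Z(2)
      by (simp add: coadj_action_mat_class class_action_mat_class[OF upward_lower] class_action_closed)
  qed
  also have "{(g, x). g \<in> carrier (U\<lparr>carrier := H\<rparr>) \<and> x \<in> F \<and> coadj_action K P g x = x} =
      map_prod (\<lambda>X. \<one>\<^bsub>M\<^esub> \<oplus>\<^bsub>M\<^esub> X) (mat_class lower) ` {(X, Z). X \<in> stab_pattern \<and> Z \<in> point_fibre \<and>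
      (\<forall>i j. less_in P j i \<longrightarrow> (X \<otimes>\<^bsub>M\<^esub> Z) i j = (Z \<otimes>\<^bsub>M\<^esub> X) i j)}" (is "?L = ?f ` ?R")
  proof -
    have fixed: "coadj_action K P (\<one>\<^bsub>M\<^esub> \<oplus>\<^bsub>M\<^esub> X) (mat_class lower Z) = mat_class lower Z \<longleftrightarrow>
        (\<forall>i j. less_in P j i \<longrightarrow> (X \<otimes>\<^bsub>M\<^esub> Z) i j = (Z \<otimes>\<^bsub>M\<^esub> X) i j)"
      if "X \<in> stab_pattern" "Z \<in> point_fibre" for X Z
    proof -
      have X: "X \<in> N" and Z: "Z \<in> carrier M"
        using that by (simp_all add: stab_pattern_def point_fibre_def)
      show ?thesis
        using class_fixed_one_add_iff[OF upward_lower X Z]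
        by (simp add: coadj_action_mat_class class_action_mat_class[OF upward_lower]
            pattern_group_one_add X Z)
    qed
    show ?thesis
      unfolding F_def H_def fibre_image stabilizer_image
    proof (intro equalityI subsetI)
      fix p assume p: "p \<in> {(g, x). g \<in> carrier (U\<lparr>carrier := (\<lambda>X. \<one>\<^bsub>M\<^esub> \<oplus>\<^bsub>M\<^esub> X) ` stab_pattern\<rparr>) \<and>
          x \<in> mat_class lower ` point_fibre \<and> coadj_action K P g x = x}"
      then obtain X Z where XZ: "X \<in> stab_pattern" "Z \<in> point_fibre"
          "p = (\<one>\<^bsub>M\<^esub> \<oplus>\<^bsub>M\<^esub> X, mat_class lower Z)"
        by auto
      then have "(X, Z) \<in> ?R"
        using p fixed[OF XZ(1,2)] by simp
      then show "p \<in> ?f ` ?R"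
        unfolding XZ(3) map_prod_simp[symmetric] by (rule imageI)
    next
      fix p assume "p \<in> ?f ` ?R"
      then obtain r where "p = ?f r" "r \<in> ?R"
        by (rule imageE)
      moreover obtain X Z where "r = (X, Z)"
        by (rule prod.exhaust)
      ultimately have "(X, Z) \<in> ?R" "p = ?f (X, Z)"
        by (simp_all only:)
      then have XZ: "X \<in> stab_pattern" "Z \<in> point_fibre"
          "\<forall>i j. less_in P j i \<longrightarrow> (X \<otimes>\<^bsub>M\<^esub> Z) i j = (Z \<otimes>\<^bsub>M\<^esub> X) i j"
          "p = (\<one>\<^bsub>M\<^esub> \<oplus>\<^bsub>M\<^esub> X, mat_class lower Z)"
        by simp_all
      have "coadj_action K P (\<one>\<^bsub>M\<^esub> \<oplus>\<^bsub>M\<^esub> X) (mat_class lower Z) = mat_class lower Z"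
        using fixed[OF XZ(1,2)] XZ(3) by (simp only:)
      then show "p \<in> {(g, x). g \<in> carrier (U\<lparr>carrier := (\<lambda>X. \<one>\<^bsub>M\<^esub> \<oplus>\<^bsub>M\<^esub> X) ` stab_pattern\<rparr>) \<and>
          x \<in> mat_class lower ` point_fibre \<and> coadj_action K P g x = x}"
        using XZ(1,2) unfolding XZ(4) by simp
    qed
  qed
  also have "card \<dots> = card {(X, Z). X \<in> stab_pattern \<and> Z \<in> point_fibre \<and>
      (\<forall>i j. less_in P j i \<longrightarrow> (X \<otimes>\<^bsub>M\<^esub> Z) i j = (Z \<otimes>\<^bsub>M\<^esub> X) i j)}"
  proof (rule card_image, rule inj_onI)
    fix p p' assume "p \<in> ?R" "p' \<in> ?R" "?f p = ?f p'"
    then show "p = p'"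
      using mat_one_add_inj[of "fst p" "fst p'"] inj_onD[OF point_fibre_inj, of "snd p" "snd p'"]
      by (cases p; cases p') (simp add: stab_pattern_def pattern_carrier)
  qed
  also have "card (carrier (U\<lparr>carrier := H\<rparr>)) = card stab_pattern"
    unfolding H_def stabilizer_image
    by (simp, rule card_image)
      (auto simp: inj_on_def stab_pattern_def mat_one_add_inj pattern_carrier)
  finally show ?thesis
    unfolding system_orbits_def Let_def antichain_point_class F_def H_def .
qed

end

section \<open>Comparison of conjugation and co-adjoint action\<close>

text \<open>Counting the pairs in \<open>R\<close> by rows and by columns gives \<open>card A + (q -
  1) * card {x \<in> A. F x} = card J + (q - 1) * card {y \<in> J. H y}\<close>. In the application
  \<open>R\<close> is the vanishing of a bilinear form and \<open>F\<close>, \<open>H\<close>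
  describe its two radicals: an element of a radical is orthogonal to everything, any other one to a
  fraction 1/q.\<close>

lemma double_count_solutions:
  assumes fin: "finite A" "finite J" and card: "card A = card J" and q: "q > (1::nat)"
    and A: "\<And>x. x \<in> A \<Longrightarrow> card {y \<in> J. R x y} * q = card J * (if F x then q else 1)"
    and J: "\<And>y. y \<in> J \<Longrightarrow> card {x \<in> A. R x y} * q = card J * (if H y then q else 1)"
  shows "card {x \<in> A. F x} = card {y \<in> J. H y}"
proof (cases "card J = 0")
  case True
  then show ?thesis
    using fin card by auto
next
  case False
  have weight: "(\<Sum>x\<in>D. (if F' x then q else 1)) = card D + card {x \<in> D. F' x} * (q - 1)"
    if "finite D" for D :: "'c set" and F'
  proof -
    have "(\<Sum>x\<in>D. (if F' x then q else 1)) = (\<Sum>x\<in>D. 1 + (if F' x then q - 1 else 0))"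
      using q by (intro sum.cong) auto
    also have "\<dots> = card D + card {x \<in> D. F' x} * (q - 1)"
      using that by (subst sum.distrib) (simp add: sum.If_cases Int_def)
    finally show ?thesis .
  qed
  have "(\<Sum>x\<in>A. card {y \<in> J. R x y}) = (\<Sum>y\<in>J. card {x \<in> A. R x y})"
    unfolding card_as_sums[OF refl fin(1)] card_as_sums[OF refl fin(2)] by (rule sum.swap)
  then have "(\<Sum>x\<in>A. card {y \<in> J. R x y} * q) = (\<Sum>y\<in>J. card {x \<in> A. R x y} * q)"
    by (simp add: sum_distrib_right[symmetric])
  then have "card J * (\<Sum>x\<in>A. (if F x then q else 1)) = card J * (\<Sum>y\<in>J. (if H y then q else 1))"
    using A J by (simp add: sum_distrib_left)
  then have "(\<Sum>x\<in>A. (if F x then q else 1)) = (\<Sum>y\<in>J. (if H y then q else 1))"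
    using False by simp
  then have "card {x \<in> A. F x} * (q - 1) = card {y \<in> J. H y} * (q - 1)"
    using weight[OF fin(1)] weight[OF fin(2)] card by simp
  then show ?thesis
    using q by simp
qed

section \<open>Linear functionals and the trace form\<close>

context matrices
begin

definition mat_scale where "mat_scale c X = (\<lambda>i j. c \<otimes> X i j)"

lemma mat_scale_closed: "c \<in> carrier K \<Longrightarrow> X \<in> carrier M \<Longrightarrow> mat_scale c X \<in> carrier M"
  by (rule mat_carrierI) (auto simp: mat_scale_def mat_closed mat_outside)

text \<open>A matrix \<open>Z\<close> with \<open>f Z = \<one>\<close>, obtained by scaling, splits
  \<open>A\<close> into the kernel of \<open>f\<close> and the line through \<open>Z\<close>. No
  dimensions are involved.\<close>

lemma kernel_card:
  assumes fin: "finite A" and sub: "A \<subseteq> carrier M"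
    and add: "\<And>X Y. X \<in> A \<Longrightarrow> Y \<in> A \<Longrightarrow> X \<oplus>\<^bsub>M\<^esub> Y \<in> A"
    and scale: "\<And>c X. c \<in> carrier K \<Longrightarrow> X \<in> A \<Longrightarrow> mat_scale c X \<in> A"
    and f: "\<And>X. X \<in> A \<Longrightarrow> f X \<in> carrier K"
    and f_add: "\<And>X Y. X \<in> A \<Longrightarrow> Y \<in> A \<Longrightarrow> f (X \<oplus>\<^bsub>M\<^esub> Y) = f X \<oplus> f Y"
    and f_scale: "\<And>c X. c \<in> carrier K \<Longrightarrow> X \<in> A \<Longrightarrow> f (mat_scale c X) = c \<otimes> f X"
    and nonzero: "\<exists>X\<in>A. f X \<noteq> \<zero>"
  shows "card {X \<in> A. f X = \<zero>} * card (carrier K) = card A"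
proof -
  obtain Y where Y: "Y \<in> A" "f Y \<noteq> \<zero>"
    using nonzero by blast
  then have fY: "f Y \<in> Units K"
    by (simp add: field_Units f)
  define Z where "Z = mat_scale (inv (f Y)) Y"
  have Z: "Z \<in> A" "f Z = \<one>"
    using Y fY by (simp_all add: Z_def scale f_scale Units_inv_closed Units_l_inv)
  have ZM: "Z \<in> carrier M"
    using Z sub by blast
  have cancel: "(X \<oplus>\<^bsub>M\<^esub> mat_scale c Z) \<oplus>\<^bsub>M\<^esub> mat_scale (\<ominus> c) Z = X"
    if "X \<in> carrier M" "c \<in> carrier K" for X c
    using that ZM
    by (intro ext) (simp add: mat_add mat_scale_def mat_closed a_assoc l_minus r_neg)
  have cancel': "(X \<oplus>\<^bsub>M\<^esub> mat_scale (\<ominus> c) Z) \<oplus>\<^bsub>M\<^esub> mat_scale c Z = X"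
    if "X \<in> carrier M" "c \<in> carrier K" for X c
    using cancel[of X "\<ominus> c"] that by simp
  have "bij_betw (\<lambda>(X, c). X \<oplus>\<^bsub>M\<^esub> mat_scale c Z) ({X \<in> A. f X = \<zero>} \<times> carrier K) A"
  proof (rule bij_betw_byWitness[where f' = "\<lambda>X. (X \<oplus>\<^bsub>M\<^esub> mat_scale (\<ominus> f X) Z, f X)"])
    show "\<forall>p\<in>{X \<in> A. f X = \<zero>} \<times> carrier K.
        (\<lambda>X. (X \<oplus>\<^bsub>M\<^esub> mat_scale (\<ominus> f X) Z, f X)) (case p of (X, c) \<Rightarrow> X \<oplus>\<^bsub>M\<^esub> mat_scale c Z) = p"
    proof
      fix p assume "p \<in> {X \<in> A. f X = \<zero>} \<times> carrier K"
      then obtain X c where p: "p = (X, c)" "X \<in> A" "f X = \<zero>" "c \<in> carrier K"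
        by auto
      then have "f (X \<oplus>\<^bsub>M\<^esub> mat_scale c Z) = c"
        using Z by (simp add: f_add f_scale scale)
      then show "(\<lambda>X. (X \<oplus>\<^bsub>M\<^esub> mat_scale (\<ominus> f X) Z, f X)) (case p of (X, c) \<Rightarrow> X \<oplus>\<^bsub>M\<^esub> mat_scale c Z) = p"
        using p sub cancel[of X c] by auto
    qed
    show "\<forall>X\<in>A. (case (X \<oplus>\<^bsub>M\<^esub> mat_scale (\<ominus> f X) Z, f X) of (X, c) \<Rightarrow> X \<oplus>\<^bsub>M\<^esub> mat_scale c Z) = X"
      using cancel' f sub by auto
    show "(\<lambda>(X, c). X \<oplus>\<^bsub>M\<^esub> mat_scale c Z) ` ({X \<in> A. f X = \<zero>} \<times> carrier K) \<subseteq> A"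
      using add scale Z by auto
    show "(\<lambda>X. (X \<oplus>\<^bsub>M\<^esub> mat_scale (\<ominus> f X) Z, f X)) ` A \<subseteq> {X \<in> A. f X = \<zero>} \<times> carrier K"
    proof (rule image_subsetI)
      fix X assume X: "X \<in> A"
      then have "f (X \<oplus>\<^bsub>M\<^esub> mat_scale (\<ominus> f X) Z) = \<zero>"
        using Z by (simp add: f_add f_scale scale f r_neg)
      then show "(X \<oplus>\<^bsub>M\<^esub> mat_scale (\<ominus> f X) Z, f X) \<in> {X \<in> A. f X = \<zero>} \<times> carrier K"
        using X Z by (simp add: add scale f)
    qed
  qed
  then show ?thesis
    using bij_betw_same_card by (fastforce simp: card_cartesian_product)
qed

lemma mat_trace_scale_left:
  assumes "c \<in> carrier K" "X \<in> carrier M" "Y \<in> carrier M"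
  shows "mat_trace (mat_scale c X \<otimes>\<^bsub>M\<^esub> Y) = c \<otimes> mat_trace (X \<otimes>\<^bsub>M\<^esub> Y)"
proof -
  have "(mat_scale c X \<otimes>\<^bsub>M\<^esub> Y) i j = c \<otimes> (X \<otimes>\<^bsub>M\<^esub> Y) i j" for i j
    unfolding mat_mult mat_scale_def
    using assms finite_index
    by (subst finsum_rdistr) (auto simp: mat_closed m_assoc intro!: finsum_cong')
  then show ?thesis
    unfolding mat_trace_def using assms finite_index
    by (subst finsum_rdistr) (auto simp: mat_closed intro!: finsum_cong')
qed

lemma mat_trace_scale_right:
  assumes "c \<in> carrier K" "X \<in> carrier M" "Y \<in> carrier M"
  shows "mat_trace (X \<otimes>\<^bsub>M\<^esub> mat_scale c Y) = c \<otimes> mat_trace (X \<otimes>\<^bsub>M\<^esub> Y)"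
  using mat_trace_scale_left[OF assms(1,3,2)] assms
  by (simp add: mat_trace_cyclic[of X] mat_scale_closed)

lemma mat_unit_closed: "i \<in> V \<Longrightarrow> j \<in> V \<Longrightarrow> mat_unit K i j \<in> carrier M"
  by (intro mat_carrierI) (auto simp: mat_unit_def)

text \<open>The source of non-degeneracy: pairing with a unit at the transposed position reads off a
  single entry.\<close>

lemma mat_trace_unit:
  assumes "W \<in> carrier M" "i \<in> V" "j \<in> V"
  shows "mat_trace (W \<otimes>\<^bsub>M\<^esub> mat_unit K j i) = W i j"
proof -
  have "(W \<otimes>\<^bsub>M\<^esub> mat_unit K j i) k k = (if k = i then W i j else \<zero>)" for k
  proof -
    have "(W \<otimes>\<^bsub>M\<^esub> mat_unit K j i) k k = W k j \<otimes> mat_unit K j i j k"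
      unfolding mat_mult
      by (rule finsum_delta) (use assms finite_index in \<open>auto simp: mat_unit_def mat_closed\<close>)
    then show ?thesis
      using assms by (simp add: mat_unit_def mat_closed)
  qed
  then have "mat_trace (W \<otimes>\<^bsub>M\<^esub> mat_unit K j i) = (\<Oplus>k\<in>V. if k = i then W i j else \<zero>)"
    unfolding mat_trace_def by simp
  also have "\<dots> = (if i = i then W i j else \<zero>)"
    by (rule finsum_delta) (use assms finite_index in \<open>auto simp: mat_closed\<close>)
  finally show ?thesis by simp
qed

end

context matrices
begin

lemma mat_trace_minus:
  assumes "X \<in> carrier M" "Y \<in> carrier M"
  shows "mat_trace (X \<ominus>\<^bsub>M\<^esub> Y) = mat_trace X \<ominus> mat_trace Y"
proof -
  have "(X \<ominus>\<^bsub>M\<^esub> Y) \<oplus>\<^bsub>M\<^esub> Y = X"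
    using assms by (simp add: mat.minus_eq mat.a_assoc mat.l_neg)
  then have "mat_trace X = mat_trace (X \<ominus>\<^bsub>M\<^esub> Y) \<oplus> mat_trace Y"
    using assms mat_trace_add[of "X \<ominus>\<^bsub>M\<^esub> Y" Y] by simp
  then show ?thesis
    using assms by (simp add: minus_eq a_assoc r_neg mat_trace_closed)
qed

end

section \<open>Duality between strictly upper and strictly lower matrices\<close>

context pattern_matrices
begin

definition lower_mats where
  "lower_mats = {Z \<in> carrier M. \<forall>i j. \<not> less_in P j i \<longrightarrow> Z i j = \<zero>}"

lemma lower_mats_carrier: "Z \<in> lower_mats \<Longrightarrow> Z \<in> carrier M"
  by (simp add: lower_mats_def)

lemma finite_lower_mats: "finite lower_mats"
  by (rule finite_subset[OF _ finite_mat_carrier[OF finite_field]]) (use lower_mats_carrier in blast)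

lemma card_lower_mats: "card lower_mats = card N"
proof (rule bij_betw_same_card)
  let ?t = "\<lambda>X i j. X j i"
  have "?t X \<in> carrier M" if "X \<in> carrier M" for X
    by (rule mat_carrierI) (auto simp: mat_closed[OF that] mat_outside[OF that])
  then have "?t Z \<in> N" if "Z \<in> lower_mats" for Z
    using that by (intro patternI) (simp_all add: lower_mats_def)
  moreover have "?t X \<in> lower_mats" if "X \<in> N" for X
    using that \<open>\<And>X. X \<in> carrier M \<Longrightarrow> ?t X \<in> carrier M\<close>
    by (simp add: lower_mats_def pattern_carrier pattern_zero)
  ultimately show "bij_betw ?t lower_mats N"
    by (intro bij_betw_byWitness[where f' = ?t]) auto
qed

lemma card_field: "card (carrier K) > 1"
proof -
  have "card {\<zero>, \<one>} \<le> card (carrier K)"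
    using finite_field by (intro card_mono) auto
  then show ?thesis by simp
qed

lemma pattern_scale: "c \<in> carrier K \<Longrightarrow> X \<in> N \<Longrightarrow> mat_scale c X \<in> N"
  by (intro patternI mat_scale_closed) (simp_all add: pattern_carrier mat_scale_def pattern_zero)

lemma lower_mats_scale: "c \<in> carrier K \<Longrightarrow> Z \<in> lower_mats \<Longrightarrow> mat_scale c Z \<in> lower_mats"
  using mat_scale_closed by (simp add: lower_mats_def) (simp add: mat_scale_def)

lemma lower_mats_add: "Y \<in> lower_mats \<Longrightarrow> Z \<in> lower_mats \<Longrightarrow> Y \<oplus>\<^bsub>M\<^esub> Z \<in> lower_mats"
  by (simp add: lower_mats_def mat_add)

lemma unit_pattern: "less_in P i j \<Longrightarrow> mat_unit K i j \<in> N"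
  using less_Field by (intro patternI mat_unit_closed) (auto simp: mat_unit_def)

lemma unit_lower_mats: "less_in P j i \<Longrightarrow> mat_unit K i j \<in> lower_mats"
  using less_Field mat_unit_closed by (auto simp: lower_mats_def mat_unit_def)

text \<open>The trace multiplies \<open>W i k\<close> only with \<open>Y k i\<close>, which is zero
  unless \<open>k\<close> lies below \<open>i\<close>. So the form depends only on the co-adjoint
  class of \<open>W\<close>.\<close>

lemma trace_lower_vanish:
  assumes W: "W \<in> carrier M" "\<And>i j. less_in P j i \<Longrightarrow> W i j = \<zero>" and Y: "Y \<in> N"
  shows "mat_trace (W \<otimes>\<^bsub>M\<^esub> Y) = \<zero>"
  unfolding mat_trace_def mat_mult
proof (intro finsum_zero')
  fix i k
  show "W i k \<otimes> Y k i = \<zero>"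
  proof (cases "less_in P k i")
    case True
    then show ?thesis
      by (simp add: W(2) mat_closed[OF pattern_carrier[OF Y]])
  next
    case False
    then show ?thesis
      by (simp add: pattern_zero[OF Y] mat_closed[OF W(1)])
  qed
qed

text \<open>The trace form pairs strictly upper with strictly lower matrices, and the co-adjoint action of
  \<open>X\<close> is transposed to its commutator. The numbers of solutions of the two linear systems are compared
  by counting the pairs on which the form vanishes, which needs no rank.\<close>

lemma card_coadjoint_fixed:
  assumes X: "X \<in> N"
  shows "card {Z \<in> lower_mats. \<forall>i j. less_in P j i \<longrightarrow> (X \<otimes>\<^bsub>M\<^esub> Z) i j = (Z \<otimes>\<^bsub>M\<^esub> X) i j} =
    card {Y \<in> N. X \<otimes>\<^bsub>M\<^esub> Y = Y \<otimes>\<^bsub>M\<^esub> X}"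
proof -
  define \<beta> where "\<beta> Z Y = mat_trace (Z \<otimes>\<^bsub>M\<^esub> (X \<otimes>\<^bsub>M\<^esub> Y \<ominus>\<^bsub>M\<^esub> Y \<otimes>\<^bsub>M\<^esub> X))" for Z Y
  have XM [simp]: "X \<in> carrier M"
    by (rule pattern_carrier[OF X])
  \<comment> \<open>Cyclicity of the trace moves the commutator with \<open>X\<close> from
    \<open>Y\<close> to \<open>Z\<close>.\<close>
  have \<beta>_eq: "\<beta> Z Y = mat_trace ((Z \<otimes>\<^bsub>M\<^esub> X \<ominus>\<^bsub>M\<^esub> X \<otimes>\<^bsub>M\<^esub> Z) \<otimes>\<^bsub>M\<^esub> Y)"
    if [simp]: "Z \<in> carrier M" "Y \<in> carrier M" for Z Y
  proof -
    have "\<beta> Z Y = mat_trace (Z \<otimes>\<^bsub>M\<^esub> X \<otimes>\<^bsub>M\<^esub> Y \<ominus>\<^bsub>M\<^esub> Z \<otimes>\<^bsub>M\<^esub> Y \<otimes>\<^bsub>M\<^esub> X)"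
      unfolding \<beta>_def by (simp add: mat.minus_eq mat.r_distr mat.r_minus mat.m_assoc)
    also have "\<dots> = mat_trace (Z \<otimes>\<^bsub>M\<^esub> X \<otimes>\<^bsub>M\<^esub> Y) \<ominus> mat_trace (Z \<otimes>\<^bsub>M\<^esub> Y \<otimes>\<^bsub>M\<^esub> X)"
      by (rule mat_trace_minus) simp_all
    also have "mat_trace (Z \<otimes>\<^bsub>M\<^esub> Y \<otimes>\<^bsub>M\<^esub> X) = mat_trace (X \<otimes>\<^bsub>M\<^esub> (Z \<otimes>\<^bsub>M\<^esub> Y))"
      by (rule mat_trace_cyclic) simp_all
    also have "mat_trace (Z \<otimes>\<^bsub>M\<^esub> X \<otimes>\<^bsub>M\<^esub> Y) \<ominus> mat_trace (X \<otimes>\<^bsub>M\<^esub> (Z \<otimes>\<^bsub>M\<^esub> Y)) =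
        mat_trace (Z \<otimes>\<^bsub>M\<^esub> X \<otimes>\<^bsub>M\<^esub> Y \<ominus>\<^bsub>M\<^esub> X \<otimes>\<^bsub>M\<^esub> (Z \<otimes>\<^bsub>M\<^esub> Y))"
      by (rule mat_trace_minus[symmetric]) simp_all
    also have "Z \<otimes>\<^bsub>M\<^esub> X \<otimes>\<^bsub>M\<^esub> Y \<ominus>\<^bsub>M\<^esub> X \<otimes>\<^bsub>M\<^esub> (Z \<otimes>\<^bsub>M\<^esub> Y) =
        (Z \<otimes>\<^bsub>M\<^esub> X \<ominus>\<^bsub>M\<^esub> X \<otimes>\<^bsub>M\<^esub> Z) \<otimes>\<^bsub>M\<^esub> Y"
      by (simp add: mat.minus_eq mat.l_distr mat.l_minus mat.m_assoc)
    finally show ?thesis .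
  qed
  show ?thesis
  proof (rule double_count_solutions[where R = "\<lambda>Z Y. \<beta> Z Y = \<zero>" and q = "card (carrier K)"])
    fix Z assume Z: "Z \<in> lower_mats"
    then have ZM [simp]: "Z \<in> carrier M"
      by (rule lower_mats_carrier)
    let ?W = "Z \<otimes>\<^bsub>M\<^esub> X \<ominus>\<^bsub>M\<^esub> X \<otimes>\<^bsub>M\<^esub> Z"
    let ?F = "\<forall>i j. less_in P j i \<longrightarrow> (X \<otimes>\<^bsub>M\<^esub> Z) i j = (Z \<otimes>\<^bsub>M\<^esub> X) i j"
    show "card {Y \<in> N. \<beta> Z Y = \<zero>} * card (carrier K) = card N * (if ?F then card (carrier K) else 1)"
    proof (cases ?F)
      case True
      then have "\<beta> Z Y = \<zero>" if "Y \<in> N" for Y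
        using that by (simp add: \<beta>_eq pattern_carrier trace_lower_vanish minus_vanish_iff)
      then have "{Y \<in> N. \<beta> Z Y = \<zero>} = N"
        by blast
      then show ?thesis
        using True by simp
    next
      case False
      then obtain i j where ij: "less_in P j i" "?W i j \<noteq> \<zero>"
        by (auto simp: minus_vanish_iff)
      \<comment> \<open>The position \<open>(j, i)\<close> is a strictly upper one, so this unit
        lies in \<open>N\<close> and shows that the functional of \<open>Z\<close> on
        \<open>N\<close> is nonzero.\<close>
      then have "\<beta> Z (mat_unit K j i) = ?W i j"
        using less_Field[OF ij(1)]
        by (simp add: \<beta>_eq mat_unit_closed mat_trace_unit)
      then have "\<exists>Y\<in>N. \<beta> Z Y \<noteq> \<zero>"
        using ij unit_pattern by metis
      then have "card {Y \<in> N. \<beta> Z Y = \<zero>} * card (carrier K) = card N"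
        by (intro kernel_card finite_pattern subsetI)
          (simp_all add: pattern_carrier pattern_add pattern_scale \<beta>_eq mat_trace_closed
            mat.r_distr mat_trace_add mat_scale_closed mat_trace_scale_right)
      then show ?thesis
        unfolding if_not_P[OF False] by simp
    qed
  next
    fix Y assume Y: "Y \<in> N"
    then have YM [simp]: "Y \<in> carrier M"
      by (rule pattern_carrier)
    let ?W = "X \<otimes>\<^bsub>M\<^esub> Y \<ominus>\<^bsub>M\<^esub> Y \<otimes>\<^bsub>M\<^esub> X"
    show "card {Z \<in> lower_mats. \<beta> Z Y = \<zero>} * card (carrier K) =
        card N * (if X \<otimes>\<^bsub>M\<^esub> Y = Y \<otimes>\<^bsub>M\<^esub> X then card (carrier K) else 1)"
    proof (cases "X \<otimes>\<^bsub>M\<^esub> Y = Y \<otimes>\<^bsub>M\<^esub> X")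
      case True
      then have "?W = \<zero>\<^bsub>M\<^esub>"
        by (simp add: mat.minus_eq_zero_iff)
      then have "\<beta> Z Y = \<zero>" if "Z \<in> lower_mats" for Z
        using that mat.zero_closed by (simp add: \<beta>_def lower_mats_carrier mat_trace_def mat_zero finsum_zero')
      then have "{Z \<in> lower_mats. \<beta> Z Y = \<zero>} = lower_mats"
        by blast
      then show ?thesis
        using True by (simp add: card_lower_mats)
    next
      case False
      then obtain i j where W: "?W i j \<noteq> \<zero>"
        by (auto simp: fun_eq_iff minus_vanish_iff)
      \<comment> \<open>Being in \<open>N\<close>, the commutator can be nonzero only at strictly
        upper positions, whose transposed units are available in \<open>lower_mats\<close>.\<close>
      have "?W \<in> N"
        using X Y by (simp add: pattern_minus pattern_mult)
      then have ij: "less_in P i j"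
        using W pattern_zero by blast
      have "\<beta> (mat_unit K j i) Y = mat_trace (?W \<otimes>\<^bsub>M\<^esub> mat_unit K j i)"
        unfolding \<beta>_def using less_Field[OF ij] by (intro mat_trace_cyclic mat_unit_closed) simp_all
      also have "\<dots> = ?W i j"
        using less_Field[OF ij] by (intro mat_trace_unit) simp_all
      finally have "\<exists>Z\<in>lower_mats. \<beta> Z Y \<noteq> \<zero>"
        using W unit_lower_mats[OF ij] by metis
      then have "card {Z \<in> lower_mats. \<beta> Z Y = \<zero>} * card (carrier K) = card lower_mats"
        by (intro kernel_card finite_lower_mats subsetI)
          (simp_all add: lower_mats_carrier lower_mats_add lower_mats_scale \<beta>_def mat_trace_closed
            mat.l_distr mat_trace_add mat_scale_closed mat_trace_scale_left)
      then show ?thesis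
        unfolding if_not_P[OF False] by (simp add: card_lower_mats)
    qed
  qed (use card_field in \<open>simp_all add: finite_pattern finite_lower_mats card_lower_mats\<close>)
qed

text \<open>This brings the class number into the shape of \<open>system_orbits_pairs\<close>, with
  a linear space in place of the affine fibre. The counts are exchanged for each \<open>X\<close>
  separately.\<close>

lemma poset_classes_coadjoint_pairs:
  "poset_classes K P * card N = card {(X, Z). X \<in> N \<and> Z \<in> lower_mats \<and>
     (\<forall>i j. less_in P j i \<longrightarrow> (X \<otimes>\<^bsub>M\<^esub> Z) i j = (Z \<otimes>\<^bsub>M\<^esub> X) i j)}"
proof -
  have "{(X, Y). X \<in> N \<and> Y \<in> N \<and> X \<otimes>\<^bsub>M\<^esub> Y = Y \<otimes>\<^bsub>M\<^esub> X} =
      (SIGMA X:N. {Y \<in> N. X \<otimes>\<^bsub>M\<^esub> Y = Y \<otimes>\<^bsub>M\<^esub> X})"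
    by auto
  then have "poset_classes K P * card N = (\<Sum>X\<in>N. card {Y \<in> N. X \<otimes>\<^bsub>M\<^esub> Y = Y \<otimes>\<^bsub>M\<^esub> X})"
    unfolding poset_classes_pairs by (simp add: finite_pattern)
  also have "\<dots> = (\<Sum>X\<in>N. card {Z \<in> lower_mats. \<forall>i j. less_in P j i \<longrightarrow> (X \<otimes>\<^bsub>M\<^esub> Z) i j = (Z \<otimes>\<^bsub>M\<^esub> X) i j})"
    by (intro sum.cong refl card_coadjoint_fixed[symmetric])
  also have "\<dots> = card (SIGMA X:N. {Z \<in> lower_mats. \<forall>i j. less_in P j i \<longrightarrow> (X \<otimes>\<^bsub>M\<^esub> Z) i j = (Z \<otimes>\<^bsub>M\<^esub> X) i j})"
    using finite_pattern finite_lower_mats by simp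
  also have "(SIGMA X:N. {Z \<in> lower_mats. \<forall>i j. less_in P j i \<longrightarrow> (X \<otimes>\<^bsub>M\<^esub> Z) i j = (Z \<otimes>\<^bsub>M\<^esub> X) i j}) =
      {(X, Z). X \<in> N \<and> Z \<in> lower_mats \<and> (\<forall>i j. less_in P j i \<longrightarrow> (X \<otimes>\<^bsub>M\<^esub> Z) i j = (Z \<otimes>\<^bsub>M\<^esub> X) i j)}"
    by auto
  finally show ?thesis .
qed

end

section \<open>Reduction of poset systems with a single-element antichain\<close>

text \<open>In a poset system \<open>a\<close> itself lies below \<open>m\<close>; the clause
  \<open>y \<noteq> a\<close> saves its reflexive pair.\<close>

definition reduced_poset :: "'v rel \<Rightarrow> 'v \<Rightarrow> 'v \<Rightarrow> 'v rel" where
  "reduced_poset P m a =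
     {(x, y) \<in> P. x \<noteq> m \<and> y \<noteq> m \<and> \<not> (x = a \<and> y \<noteq> a \<and> less_in P y m)}"

lemma less_in_reduced_poset:
  "less_in (reduced_poset P m a) x y \<longleftrightarrow>
     less_in P x y \<and> x \<noteq> m \<and> y \<noteq> m \<and> \<not> (x = a \<and> less_in P y m)"
  by (auto simp: less_in_def reduced_poset_def)

context finite_order
begin

lemma Field_reduced: "Field (reduced_poset P m a) = Field P - {m}"
proof
  show "Field (reduced_poset P m a) \<subseteq> Field P - {m}"
    by (auto simp: Field_def reduced_poset_def)
  show "Field P - {m} \<subseteq> Field (reduced_poset P m a)"
  proof
    fix x assume "x \<in> Field P - {m}"
    then have "(x, x) \<in> reduced_poset P m a"
      using le_refl by (simp add: reduced_poset_def)
    then show "x \<in> Field (reduced_poset P m a)"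
      by (rule FieldI1)
  qed
qed

lemma finite_poset_reduced: "finite_poset (reduced_poset P m a)"
proof -
  have "\<forall>x\<in>Field (reduced_poset P m a). (x, x) \<in> reduced_poset P m a"
    unfolding Field_reduced using le_refl by (simp add: reduced_poset_def)
  moreover have "antisym (reduced_poset P m a)"
    using le_antisym by (auto simp: antisym_def reduced_poset_def)
  moreover have "trans (reduced_poset P m a)"
  proof (rule transI)
    fix x y z assume xyz: "(x, y) \<in> reduced_poset P m a" "(y, z) \<in> reduced_poset P m a"
    then have P: "(x, y) \<in> P" "(y, z) \<in> P" and m: "x \<noteq> m" "z \<noteq> m"
      by (auto simp: reduced_poset_def)
    \<comment> \<open>If the composite pair were removed, then \<open>y\<close> would lie below
      \<open>m\<close> as well, so \<open>(a, y)\<close> would be missing already, or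
      \<open>(a, z)\<close> itself in the case \<open>y = a\<close>.\<close>
    have "\<not> (x = a \<and> z \<noteq> a \<and> less_in P z m)"
    proof
      assume *: "x = a \<and> z \<noteq> a \<and> less_in P z m"
      then have "less_in P y m"
        using P(2) le_less_trans by blast
      then show False
        using * xyz by (auto simp: reduced_poset_def)
    qed
    then show "(x, z) \<in> reduced_poset P m a"
      using le_trans[OF P] m by (simp add: reduced_poset_def)
  qed
  moreover have "finite (Field (reduced_poset P m a))"
    by (simp add: Field_reduced finite_Field)
  ultimately show ?thesis
    by (auto simp: finite_poset_def order_on_defs refl_on_def intro: FieldI1 FieldI2)
qed

end

context pattern_matrices
begin

text \<open>The index set disappears, because strict relations stay inside the field. Matrices for
  \<open>P\<close> and for the reduced poset thereby become comparable as functions on the same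
  type.\<close>

lemma pattern_iff: "X \<in> N \<longleftrightarrow> (\<forall>i j. X i j \<in> carrier K \<and> (\<not> less_in P i j \<longrightarrow> X i j = \<zero>))"
proof
  assume "X \<in> N"
  then show "\<forall>i j. X i j \<in> carrier K \<and> (\<not> less_in P i j \<longrightarrow> X i j = \<zero>)"
    by (simp add: mat_closed pattern_carrier pattern_zero)
next
  assume *: "\<forall>i j. X i j \<in> carrier K \<and> (\<not> less_in P i j \<longrightarrow> X i j = \<zero>)"
  then show "X \<in> N"
    by (intro patternI mat_carrierI) (use less_Field in blast)+
qed

lemma lower_mats_iff:
  "X \<in> lower_mats \<longleftrightarrow> (\<forall>i j. X i j \<in> carrier K \<and> (\<not> less_in P j i \<longrightarrow> X i j = \<zero>))"
proof
  assume "X \<in> lower_mats"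
  then show "\<forall>i j. X i j \<in> carrier K \<and> (\<not> less_in P j i \<longrightarrow> X i j = \<zero>)"
    by (simp add: mat_closed lower_mats_def)
next
  assume *: "\<forall>i j. X i j \<in> carrier K \<and> (\<not> less_in P j i \<longrightarrow> X i j = \<zero>)"
  then have "X \<in> carrier M"
    by (intro mat_carrierI) (use less_Field in blast)+
  then show "X \<in> lower_mats"
    using * unfolding lower_mats_def by blast
qed

end

context pattern_system
begin

abbreviation Q where "Q \<equiv> reduced_poset P m a"

lemma a_neq_m: "a \<noteq> m"
  using a_less_m by (simp add: less_in_def)

end

sublocale pattern_system \<subseteq> red: pattern_matrices K "reduced_poset P m a"
  by unfold_locales (simp_all add: finite_poset_reduced finite_field)

section \<open>Stripping a fixed pair down to the reduced poset\<close>

context pattern_system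
begin

definition strip_upper where
  "strip_upper X = (\<lambda>i j. if j = m then \<zero> else X i j)"

definition strip_lower where
  "strip_lower Z = (\<lambda>i j. if i = m \<or> (j = a \<and> less_in P a i \<and> less_in P i m) then \<zero> else Z i j)"

text \<open>These vectors serve twice: as the columns \<open>m\<close> of stabilizer matrices
  (\<open>card_stab_pattern\<close>) and as the free parameters of a fixed pair
  (\<open>column_entries\<close>). This coincidence makes the two excess factors equal.\<close>

definition new_entries where
  "new_entries = {v. \<forall>i. v i \<in> carrier K \<and> (\<not> less_in P i m \<longrightarrow> v i = \<zero>)}"

lemma strip_upper_reduced: "X \<in> stab_pattern \<Longrightarrow> strip_upper X \<in> red.N"
  unfolding red.pattern_iff less_in_reduced_poset
  by (auto simp: strip_upper_def stab_pattern_def pattern_zero m_max mat_closed[OF pattern_carrier])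

lemma strip_lower_reduced: "Z \<in> point_fibre \<Longrightarrow> strip_lower Z \<in> red.lower_mats"
  unfolding red.lower_mats_iff less_in_reduced_poset
  by (auto simp: strip_lower_def point_fibre_def m_max mat_closed)

lemma card_stab_pattern: "card stab_pattern = card red.N * card new_entries"
proof -
  let ?f = "\<lambda>(X, v). \<lambda>i j. if j = m then v i else X i j"
  have "bij_betw ?f (red.N \<times> new_entries) stab_pattern"
  proof (rule bij_betw_byWitness[where f' = "\<lambda>X. (strip_upper X, \<lambda>i. X i m)"])
    show "\<forall>p\<in>red.N \<times> new_entries. (\<lambda>X. (strip_upper X, \<lambda>i. X i m)) (?f p) = p"
      by (auto simp: strip_upper_def red.pattern_iff less_in_reduced_poset fun_eq_iff)
    show "\<forall>X\<in>stab_pattern. ?f (strip_upper X, \<lambda>i. X i m) = X"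
      by (auto simp: strip_upper_def fun_eq_iff)
    show "?f ` (red.N \<times> new_entries) \<subseteq> stab_pattern"
      by (auto simp: stab_pattern_def pattern_iff red.pattern_iff less_in_reduced_poset new_entries_def
          a_neq_m m_max)
    show "(\<lambda>X. (strip_upper X, \<lambda>i. X i m)) ` stab_pattern \<subseteq> red.N \<times> new_entries"
      using strip_upper_reduced by (auto simp: new_entries_def stab_pattern_def pattern_iff)
  qed
  then have "card (red.N \<times> new_entries) = card stab_pattern"
    by (rule bij_betw_same_card)
  then show ?thesis
    by (simp add: card_cartesian_product)
qed

text \<open>Both rings consist of functions on the whole type, and their products differ only by the
  summand with middle index \<open>m\<close>.\<close>

lemma red_mult:
  assumes "X \<in> carrier M" "Y \<in> carrier M" "X i m \<otimes> Y m j = \<zero>"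
  shows "(X \<otimes>\<^bsub>red.M\<^esub> Y) i j = (X \<otimes>\<^bsub>M\<^esub> Y) i j"
proof -
  have "(\<Oplus>k\<in>Field P. X i k \<otimes> Y k j) = (\<Oplus>k\<in>insert m (Field P - {m}). X i k \<otimes> Y k j)"
    using m_Field by (simp add: insert_absorb)
  also have "\<dots> = X i m \<otimes> Y m j \<oplus> (\<Oplus>k\<in>Field P - {m}. X i k \<otimes> Y k j)"
    using assms finite_index by (intro finsum_insert) (auto simp: mat_closed)
  also have "\<dots> = (\<Oplus>k\<in>Field P - {m}. X i k \<otimes> Y k j)"
    using assms by (simp add: finsum_closed' mat_closed)
  finally show ?thesis
    unfolding mat_mult red.mat_mult unfolding Field_reduced by (rule sym)
qed

context
  fixes X Z
  assumes X: "X \<in> stab_pattern" and Z: "Z \<in> point_fibre"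
begin

lemma stab_in_pattern: "X \<in> N" and stab_carrier: "X \<in> carrier M" and fibre_carrier: "Z \<in> carrier M"
  and stab_row: "\<And>j. less_in P j m \<Longrightarrow> X a j = \<zero>"
  and fibre_row: "\<And>j. less_in P j m \<Longrightarrow> Z m j = (if j = a then \<one> else \<zero>)"
  using X Z by (auto simp: stab_pattern_def point_fibre_def pattern_carrier mat_unit_def)

lemma strip_upper_mat: "strip_upper X \<in> carrier M"
  using stab_carrier by (intro mat_carrierI) (auto simp: strip_upper_def mat_closed mat_outside)

lemma strip_lower_mat: "strip_lower Z \<in> carrier M"
  using fibre_carrier by (intro mat_carrierI) (auto simp: strip_lower_def mat_closed mat_outside)

lemma mult_strip_upper_left:
  "(X \<otimes>\<^bsub>M\<^esub> Z) i j = X i m \<otimes> Z m j \<oplus> (strip_upper X \<otimes>\<^bsub>M\<^esub> Z) i j"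
proof -
  let ?D = "\<lambda>i j. if j = m then X i m else \<zero>"
  have D: "?D \<in> carrier M"
    using stab_carrier by (intro mat_carrierI) (auto simp: mat_closed mat_outside)
  have "?D \<oplus>\<^bsub>M\<^esub> strip_upper X = X"
    by (intro ext) (simp add: mat_add strip_upper_def mat_closed[OF stab_carrier])
  then have "X \<otimes>\<^bsub>M\<^esub> Z = ?D \<otimes>\<^bsub>M\<^esub> Z \<oplus>\<^bsub>M\<^esub> strip_upper X \<otimes>\<^bsub>M\<^esub> Z"
    using mat.l_distr[OF D strip_upper_mat fibre_carrier] by (simp only:)
  then have "(X \<otimes>\<^bsub>M\<^esub> Z) i j = (?D \<otimes>\<^bsub>M\<^esub> Z) i j \<oplus> (strip_upper X \<otimes>\<^bsub>M\<^esub> Z) i j"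
    by (simp only: mat_add)
  moreover have "(?D \<otimes>\<^bsub>M\<^esub> Z) i j = ?D i m \<otimes> Z m j"
    unfolding mat_mult
    by (rule finsum_delta) (use finite_index m_Field in \<open>auto simp: mat_closed[OF stab_carrier] mat_closed[OF fibre_carrier]\<close>)
  ultimately show ?thesis by simp
qed

lemma mult_strip_upper_right:
  "j \<noteq> m \<Longrightarrow> (Z \<otimes>\<^bsub>M\<^esub> X) i j = (Z \<otimes>\<^bsub>M\<^esub> strip_upper X) i j"
  by (simp add: mat_mult strip_upper_def)

text \<open>Erased entries of \<open>Z\<close> do not contribute at positions of \<open>Q\<close>.
  In the first product an erased \<open>Z k a\<close> with \<open>k\<close> below \<open>m\<close>
  would need \<open>i\<close> below \<open>k\<close>, but then \<open>(a, i)\<close> is no relation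
  of \<open>Q\<close>. In the second an erased \<open>Z i a\<close> meets \<open>X a j\<close> with
  \<open>j\<close> below \<open>m\<close>, which is zero on the stabilizer.\<close>

lemma mult_strip_lower:
  assumes "less_in Q j i"
  shows "(strip_upper X \<otimes>\<^bsub>red.M\<^esub> strip_lower Z) i j = (strip_upper X \<otimes>\<^bsub>M\<^esub> Z) i j"
    and "(strip_lower Z \<otimes>\<^bsub>red.M\<^esub> strip_upper X) i j = (Z \<otimes>\<^bsub>M\<^esub> strip_upper X) i j"
proof -
  have ji: "less_in P j i" "j \<noteq> m" "i \<noteq> m" "\<not> (j = a \<and> less_in P i m)"
    using assms by (auto simp: less_in_reduced_poset)
  have upper: "strip_upper X k l = \<zero>" if "\<not> less_in P k l" for k l
    using that by (simp add: strip_upper_def pattern_zero[OF stab_in_pattern])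
  have "(strip_upper X \<otimes>\<^bsub>red.M\<^esub> strip_lower Z) i j = (strip_upper X \<otimes>\<^bsub>M\<^esub> strip_lower Z) i j"
    by (rule red_mult)
      (simp_all add: strip_upper_mat strip_lower_mat strip_upper_def[of X, THEN fun_cong, THEN fun_cong]
        mat_closed[OF strip_lower_mat])
  also have "\<dots> = (strip_upper X \<otimes>\<^bsub>M\<^esub> Z) i j"
    unfolding mat_mult
  proof (rule finsum_cong')
    fix k
    show "strip_upper X i k \<otimes> strip_lower Z k j = strip_upper X i k \<otimes> Z k j"
    proof (cases "k = m \<or> (j = a \<and> less_in P a k \<and> less_in P k m)")
      case True
      have "strip_upper X i k = \<zero>"
      proof (cases "k = m")
        case False
        then have "\<not> less_in P i k"
          using True ji(4) less_trans by blast
        then show ?thesis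
          by (rule upper)
      qed (simp add: strip_upper_def)
      then show ?thesis
        by (simp add: mat_closed[OF strip_lower_mat] mat_closed[OF fibre_carrier])
    qed (auto simp: strip_lower_def)
  qed (simp_all add: mat_closed[OF strip_upper_mat] mat_closed[OF fibre_carrier])
  finally show "(strip_upper X \<otimes>\<^bsub>red.M\<^esub> strip_lower Z) i j = (strip_upper X \<otimes>\<^bsub>M\<^esub> Z) i j" .
  have "(strip_lower Z \<otimes>\<^bsub>red.M\<^esub> strip_upper X) i j = (strip_lower Z \<otimes>\<^bsub>M\<^esub> strip_upper X) i j"
    by (rule red_mult) (simp_all add: strip_upper_mat strip_lower_mat upper m_max mat_closed[OF strip_lower_mat])
  also have "\<dots> = (Z \<otimes>\<^bsub>M\<^esub> strip_upper X) i j"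
    unfolding mat_mult
  proof (rule finsum_cong')
    fix k
    show "strip_lower Z i k \<otimes> strip_upper X k j = Z i k \<otimes> strip_upper X k j"
    proof (cases "k = a \<and> less_in P i m")
      case True
      then have "less_in P j m"
        using ji(1) less_trans by blast
      then have "strip_upper X k j = \<zero>"
        using True by (simp add: strip_upper_def stab_row)
      then show ?thesis
        by (simp add: mat_closed[OF strip_lower_mat] mat_closed[OF fibre_carrier])
    next
      case False
      then have "strip_lower Z i k = Z i k"
        using ji(3) by (auto simp: strip_lower_def)
      then show ?thesis by simp
    qed
  qed (simp_all add: mat_closed[OF strip_upper_mat] mat_closed[OF fibre_carrier])
  finally show "(strip_lower Z \<otimes>\<^bsub>red.M\<^esub> strip_upper X) i j = (Z \<otimes>\<^bsub>M\<^esub> strip_upper X) i j" .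
qed

text \<open>Row \<open>m\<close> imposes no condition. Row \<open>m\<close> of \<open>X\<close> is
  zero, and in the other product only the entry \<open>Z m a\<close> could survive, where it meets
  the vanishing part of row \<open>a\<close> of \<open>X\<close>.\<close>

lemma commute_top_row:
  assumes "less_in P j m"
  shows "(X \<otimes>\<^bsub>M\<^esub> Z) m j = (Z \<otimes>\<^bsub>M\<^esub> X) m j"
proof -
  have "(X \<otimes>\<^bsub>M\<^esub> Z) m j = \<zero>"
    unfolding mat_mult
    by (rule finsum_zero') (simp add: pattern_zero[OF stab_in_pattern m_max] mat_closed[OF fibre_carrier])
  moreover have "(Z \<otimes>\<^bsub>M\<^esub> X) m j = \<zero>"
    unfolding mat_mult
  proof (rule finsum_zero')
    fix k
    show "Z m k \<otimes> X k j = \<zero>"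
    proof (cases "less_in P k j \<and> k \<noteq> a")
      case True
      then have "less_in P k m"
        using assms less_trans by blast
      then have "Z m k = \<zero>"
        using True by (simp add: fibre_row)
      then show ?thesis
        by (simp add: mat_closed[OF stab_carrier])
    next
      case False
      then have "X k j = \<zero>"
        using assms stab_row pattern_zero[OF stab_in_pattern] by blast
      then show ?thesis
        by (simp add: mat_closed[OF fibre_carrier])
    qed
  qed
  ultimately show ?thesis by simp
qed

text \<open>The lower positions fall into three kinds: row \<open>m\<close>, where nothing is
  required; positions of \<open>Q\<close>, which see only the stripped matrices; and
  \<open>(i, a)\<close> with \<open>i\<close> strictly between \<open>a\<close> and
  \<open>m\<close>. In the last kind \<open>X i m\<close> occurs with coefficient
  \<open>Z m a = 1\<close>, so the equation determines it.\<close>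

lemma fixed_iff_reduced:
  "(\<forall>i j. less_in P j i \<longrightarrow> (X \<otimes>\<^bsub>M\<^esub> Z) i j = (Z \<otimes>\<^bsub>M\<^esub> X) i j) \<longleftrightarrow>
   (\<forall>i j. less_in Q j i \<longrightarrow>
     (strip_upper X \<otimes>\<^bsub>red.M\<^esub> strip_lower Z) i j = (strip_lower Z \<otimes>\<^bsub>red.M\<^esub> strip_upper X) i j) \<and>
   (\<forall>i. less_in P a i \<and> less_in P i m \<longrightarrow>
     X i m = (Z \<otimes>\<^bsub>M\<^esub> strip_upper X) i a \<ominus> (strip_upper X \<otimes>\<^bsub>M\<^esub> Z) i a)"
    (is "?L \<longleftrightarrow> ?A \<and> ?B")
proof -
  have reduced: "(X \<otimes>\<^bsub>M\<^esub> Z) i j = (Z \<otimes>\<^bsub>M\<^esub> X) i j \<longleftrightarrow>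
      (strip_upper X \<otimes>\<^bsub>red.M\<^esub> strip_lower Z) i j = (strip_lower Z \<otimes>\<^bsub>red.M\<^esub> strip_upper X) i j"
    if ji: "less_in Q j i" for i j
  proof -
    have *: "less_in P j i" "j \<noteq> m" "\<not> (j = a \<and> less_in P i m)"
      using ji by (auto simp: less_in_reduced_poset)
    \<comment> \<open>Below \<open>m\<close>, row \<open>m\<close> of \<open>Z\<close> is nonzero
      only at \<open>a\<close>, and \<open>j = a\<close> with \<open>i\<close> below
      \<open>m\<close> is excluded by \<open>Q\<close>.\<close>
    have "X i m \<otimes> Z m j = \<zero>"
    proof (cases "less_in P i m")
      case True
      then have "Z m j = \<zero>"
        using * less_trans by (auto simp: fibre_row)
      then show ?thesis
        by (simp add: mat_closed[OF stab_carrier])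
    next
      case False
      then show ?thesis
        by (simp add: pattern_zero[OF stab_in_pattern] mat_closed[OF fibre_carrier])
    qed
    then show ?thesis
      using *(2) ji strip_upper_mat fibre_carrier
      by (simp add: mult_strip_upper_left mult_strip_upper_right mult_strip_lower mat_closed)
  qed
  have column: "(X \<otimes>\<^bsub>M\<^esub> Z) i a = (Z \<otimes>\<^bsub>M\<^esub> X) i a \<longleftrightarrow>
      X i m = (Z \<otimes>\<^bsub>M\<^esub> strip_upper X) i a \<ominus> (strip_upper X \<otimes>\<^bsub>M\<^esub> Z) i a" for i
  proof -
    have c: "X i m \<in> carrier K" "(strip_upper X \<otimes>\<^bsub>M\<^esub> Z) i a \<in> carrier K"
        "(Z \<otimes>\<^bsub>M\<^esub> strip_upper X) i a \<in> carrier K"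
      using stab_carrier fibre_carrier strip_upper_mat by (simp_all add: mat_closed)
    then have "x \<oplus> y = z \<longleftrightarrow> x = z \<ominus> y"
      if "x \<in> carrier K" "y \<in> carrier K" "z \<in> carrier K" for x y z
      using that by (auto simp: minus_eq a_assoc r_neg l_neg)
    then show ?thesis
      using c by (simp add: mult_strip_upper_left mult_strip_upper_right a_neq_m fibre_row a_less_m)
  qed
  show ?thesis
  proof
    assume L: ?L
    then have ?A
      using reduced by (simp add: less_in_reduced_poset)
    moreover have ?B
      using L column by blast
    ultimately show "?A \<and> ?B" ..
  next
    assume AB: "?A \<and> ?B"
    show ?L
    proof (intro allI impI)
      fix i j assume ji: "less_in P j i"
      consider "i = m" | "less_in Q j i" | "i \<noteq> m" "j = a" "less_in P i m"
        using ji m_max by (auto simp: less_in_reduced_poset)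
      then show "(X \<otimes>\<^bsub>M\<^esub> Z) i j = (Z \<otimes>\<^bsub>M\<^esub> X) i j"
      proof cases
        case 1
        then show ?thesis using commute_top_row ji by simp
      next
        case 2
        then show ?thesis using AB reduced by simp
      next
        case 3
        then show ?thesis using AB column ji by simp
      qed
    qed
  qed
qed

end

end

section \<open>Rebuilding fixed pairs and counting them\<close>

context pattern_system
begin

definition fill_lower where
  "fill_lower Z v = (\<lambda>i j. if i = m then E m j
     else if j = a \<and> less_in P a i \<and> less_in P i m then v i else Z i j)"

text \<open>\<open>X\<close> is meant to be stripped and \<open>Z\<close> to be already filled. The
  conditional value solves the column equation of \<open>fixed_iff_reduced\<close>; the rest of
  column \<open>m\<close> is free and taken from \<open>v\<close>.\<close>

definition fill_upper where
  "fill_upper X Z v = (\<lambda>i j. if j = m then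
       if less_in P a i \<and> less_in P i m then (Z \<otimes>\<^bsub>M\<^esub> X) i a \<ominus> (X \<otimes>\<^bsub>M\<^esub> Z) i a else v i
     else X i j)"

text \<open>One vector stores both kinds of free parameters: \<open>Z i a\<close> where
  \<open>X i m\<close> is forced, and \<open>X i m\<close> elsewhere.\<close>

definition column_entries where
  "column_entries X Z = (\<lambda>i. if less_in P a i \<and> less_in P i m then Z i a else X i m)"

lemma E_entry: "E m j = (if j = a then \<one> else \<zero>)"
  by (simp add: mat_unit_def)

lemma red_pattern: "X \<in> red.N \<Longrightarrow> X \<in> N"
  unfolding red.pattern_iff pattern_iff less_in_reduced_poset by blast

lemma fill_lower_fibre:
  assumes Z: "Z \<in> red.lower_mats" and v: "v \<in> new_entries"
  shows "fill_lower Z v \<in> point_fibre"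
proof -
  have Z': "Z i j \<in> carrier K" "\<not> less_in P j i \<Longrightarrow> Z i j = \<zero>" for i j
    using Z unfolding red.lower_mats_iff less_in_reduced_poset by blast+
  have zero: "fill_lower Z v i j = \<zero>" if "\<not> less_in P j i" for i j
    using that a_less_m by (auto simp: fill_lower_def Z' E_entry)
  have "fill_lower Z v \<in> carrier M"
  proof (rule mat_carrierI)
    show "fill_lower Z v i j \<in> carrier K" for i j
      using v by (simp add: fill_lower_def Z' E_entry new_entries_def)
    show "fill_lower Z v i j = \<zero>" if "i \<notin> Field P \<or> j \<notin> Field P" for i j
      using that less_Field by (intro zero) blast
  qed
  then show ?thesis
    using zero by (simp add: point_fibre_def) (simp add: fill_lower_def)
qed

lemma fill_upper_stab:
  assumes X: "X \<in> red.N" and Z: "Z \<in> carrier M" and v: "v \<in> new_entries"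
  shows "fill_upper X Z v \<in> stab_pattern"
proof -
  have X': "X i j \<in> carrier K" "\<not> less_in Q i j \<Longrightarrow> X i j = \<zero>" for i j
    using X unfolding red.pattern_iff by blast+
  have v': "v i \<in> carrier K" "\<not> less_in P i m \<Longrightarrow> v i = \<zero>" for i
    using v unfolding new_entries_def by blast+
  have "(Z \<otimes>\<^bsub>M\<^esub> X) i a \<in> carrier K" "(X \<otimes>\<^bsub>M\<^esub> Z) i a \<in> carrier K" for i
    using Z pattern_carrier[OF red_pattern[OF X]] by (simp_all add: mat_closed)
  then have "fill_upper X Z v i j \<in> carrier K" for i j
    by (simp add: fill_upper_def X' v')
  moreover have "fill_upper X Z v i j = \<zero>" if "\<not> less_in P i j" for i j
    using that by (auto simp: fill_upper_def X' v' less_in_reduced_poset)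
  moreover have "fill_upper X Z v a j = \<zero>" if "less_in P j m" for j
    using that less_irrefl by (auto simp: fill_upper_def X' less_in_reduced_poset)
  ultimately show ?thesis
    by (simp add: stab_pattern_def pattern_iff)
qed

lemma strip_fill_upper:
  assumes "X \<in> red.N"
  shows "strip_upper (fill_upper X Z v) = X"
proof (intro ext)
  fix i j
  have "X i m = \<zero>"
    using assms unfolding red.pattern_iff less_in_reduced_poset by blast
  then show "strip_upper (fill_upper X Z v) i j = X i j"
    by (simp add: strip_upper_def fill_upper_def)
qed

lemma strip_fill_lower:
  assumes "Z \<in> red.lower_mats"
  shows "strip_lower (fill_lower Z v) = Z"
proof (intro ext)
  fix i j
  have "i = m \<or> (j = a \<and> less_in P i m) \<Longrightarrow> Z i j = \<zero>"
    using assms unfolding red.lower_mats_iff less_in_reduced_poset by blast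
  then show "strip_lower (fill_lower Z v) i j = Z i j"
    by (auto simp: strip_lower_def fill_lower_def)
qed

lemma fill_strip_lower:
  assumes "Z \<in> point_fibre"
  shows "fill_lower (strip_lower Z) (column_entries X Z) = Z"
proof (intro ext)
  fix i j
  have "Z m j = E m j"
    using assms a_less_m by (cases "less_in P j m") (auto simp: point_fibre_def E_entry)
  then show "fill_lower (strip_lower Z) (column_entries X Z) i j = Z i j"
    by (simp add: fill_lower_def strip_lower_def column_entries_def)
qed

definition system_pairs where
  "system_pairs = {(X, Z). X \<in> stab_pattern \<and> Z \<in> point_fibre \<and>
     (\<forall>i j. less_in P j i \<longrightarrow> (X \<otimes>\<^bsub>M\<^esub> Z) i j = (Z \<otimes>\<^bsub>M\<^esub> X) i j)}"

definition reduced_pairs where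
  "reduced_pairs = {(X, Z). X \<in> red.N \<and> Z \<in> red.lower_mats \<and>
     (\<forall>i j. less_in Q j i \<longrightarrow> (X \<otimes>\<^bsub>red.M\<^esub> Z) i j = (Z \<otimes>\<^bsub>red.M\<^esub> X) i j)}"

lemma fill_pair:
  assumes XZ: "(X, Z) \<in> reduced_pairs" and v: "v \<in> new_entries"
  shows "(fill_upper X (fill_lower Z v) v, fill_lower Z v) \<in> system_pairs"
proof -
  have X: "X \<in> red.N" and Z: "Z \<in> red.lower_mats"
      and fixed: "\<And>i j. less_in Q j i \<Longrightarrow> (X \<otimes>\<^bsub>red.M\<^esub> Z) i j = (Z \<otimes>\<^bsub>red.M\<^esub> X) i j"
    using XZ unfolding reduced_pairs_def by blast+
  have Z': "fill_lower Z v \<in> point_fibre"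
    by (rule fill_lower_fibre[OF Z v])
  then have X': "fill_upper X (fill_lower Z v) v \<in> stab_pattern"
    by (intro fill_upper_stab[OF X _ v]) (simp add: point_fibre_def)
  have "fill_upper X (fill_lower Z v) v i m =
      (fill_lower Z v \<otimes>\<^bsub>M\<^esub> X) i a \<ominus> (X \<otimes>\<^bsub>M\<^esub> fill_lower Z v) i a"
    if "less_in P a i \<and> less_in P i m" for i
    using that by (simp add: fill_upper_def)
  then have "\<forall>i j. less_in P j i \<longrightarrow>
      (fill_upper X (fill_lower Z v) v \<otimes>\<^bsub>M\<^esub> fill_lower Z v) i j =
      (fill_lower Z v \<otimes>\<^bsub>M\<^esub> fill_upper X (fill_lower Z v) v) i j"
    unfolding fixed_iff_reduced[OF X' Z'] strip_fill_upper[OF X] strip_fill_lower[OF Z]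
    using fixed by blast
  then show ?thesis
    using X' Z' unfolding system_pairs_def by blast
qed

lemma strip_pair:
  assumes XZ: "(X, Z) \<in> system_pairs"
  shows "(strip_upper X, strip_lower Z) \<in> reduced_pairs" "column_entries X Z \<in> new_entries"
    "fill_upper (strip_upper X) Z (column_entries X Z) = X"
proof -
  have X: "X \<in> stab_pattern" and Z: "Z \<in> point_fibre"
      and "\<forall>i j. less_in P j i \<longrightarrow> (X \<otimes>\<^bsub>M\<^esub> Z) i j = (Z \<otimes>\<^bsub>M\<^esub> X) i j"
    using XZ unfolding system_pairs_def by blast+
  then have fixed: "\<And>i j. less_in Q j i \<Longrightarrow>
        (strip_upper X \<otimes>\<^bsub>red.M\<^esub> strip_lower Z) i j = (strip_lower Z \<otimes>\<^bsub>red.M\<^esub> strip_upper X) i j"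
      and column: "\<And>i. less_in P a i \<and> less_in P i m \<Longrightarrow>
        X i m = (Z \<otimes>\<^bsub>M\<^esub> strip_upper X) i a \<ominus> (strip_upper X \<otimes>\<^bsub>M\<^esub> Z) i a"
    unfolding fixed_iff_reduced[OF X Z] by blast+
  show "(strip_upper X, strip_lower Z) \<in> reduced_pairs"
    using fixed strip_upper_reduced[OF X] strip_lower_reduced[OF Z]
    unfolding reduced_pairs_def by blast
  show "column_entries X Z \<in> new_entries"
    using X Z by (auto simp: new_entries_def column_entries_def stab_pattern_def point_fibre_def
        mat_closed pattern_carrier pattern_zero)
  show "fill_upper (strip_upper X) Z (column_entries X Z) = X"
  proof (intro ext)
    fix i j
    show "fill_upper (strip_upper X) Z (column_entries X Z) i j = X i j"
    proof (cases "j = m")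
      case True
      then show ?thesis
        using column[of i] by (auto simp: fill_upper_def column_entries_def)
    qed (simp add: fill_upper_def strip_upper_def)
  qed
qed

text \<open>Filling inverts stripping once the parameter vector is known. The lower matrix is filled
  first because the forced part of column \<open>m\<close> is computed from it.\<close>

lemma card_system_pairs: "card system_pairs = card reduced_pairs * card new_entries"
proof -
  let ?f = "\<lambda>((X, Z), v). (fill_upper X (fill_lower Z v) v, fill_lower Z v)"
  let ?g = "\<lambda>(X, Z). ((strip_upper X, strip_lower Z), column_entries X Z)"
  have "bij_betw ?f (reduced_pairs \<times> new_entries) system_pairs"
  proof (rule bij_betw_byWitness[where f' = ?g])
    show "\<forall>p\<in>reduced_pairs \<times> new_entries. ?g (?f p) = p"
    proof
      fix p assume "p \<in> reduced_pairs \<times> new_entries"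
      moreover obtain X Z v where p: "p = ((X, Z), v)"
        by (metis prod.exhaust)
      ultimately have "(X, Z) \<in> reduced_pairs"
        by simp
      then have XZ: "X \<in> red.N" "Z \<in> red.lower_mats"
        unfolding reduced_pairs_def by blast+
      have "column_entries (fill_upper X (fill_lower Z v) v) (fill_lower Z v) = v"
        using less_irrefl by (auto simp: fun_eq_iff column_entries_def fill_upper_def fill_lower_def)
      then show "?g (?f p) = p"
        unfolding p by (simp add: strip_fill_upper XZ strip_fill_lower)
    qed
    show "\<forall>p\<in>system_pairs. ?f (?g p) = p"
    proof
      fix p assume "p \<in> system_pairs"
      moreover obtain X Z where p: "p = (X, Z)"
        by (rule prod.exhaust)
      ultimately have XZ: "(X, Z) \<in> system_pairs"
        by simp
      then have "Z \<in> point_fibre"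
        unfolding system_pairs_def by blast
      then show "?f (?g p) = p"
        unfolding p by (simp add: fill_strip_lower strip_pair(3)[OF XZ])
    qed
    show "?f ` (reduced_pairs \<times> new_entries) \<subseteq> system_pairs"
      using fill_pair by fastforce
    show "?g ` system_pairs \<subseteq> reduced_pairs \<times> new_entries"
      using strip_pair(1,2) by fastforce
  qed
  then have "card (reduced_pairs \<times> new_entries) = card system_pairs"
    by (rule bij_betw_same_card)
  then show ?thesis
    by (simp add: card_cartesian_product)
qed

lemma system_orbits_eq_poset_classes:
  "system_orbits K P m {a} = poset_classes K Q"
proof -
  have "system_orbits K P m {a} * card stab_pattern = card reduced_pairs * card new_entries"
    unfolding system_orbits_pairs system_pairs_def[symmetric] by (rule card_system_pairs)
  also have "\<dots> = poset_classes K Q * card stab_pattern"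
    unfolding card_stab_pattern reduced_pairs_def red.poset_classes_coadjoint_pairs[symmetric] by simp
  finally have "system_orbits K P m {a} * card stab_pattern = poset_classes K Q * card stab_pattern" .
  \<comment> \<open>Together with finiteness this makes the factor to be cancelled positive.\<close>
  moreover have "(\<lambda>i j. \<zero>) \<in> stab_pattern"
    by (simp add: stab_pattern_def pattern_iff)
  moreover have "finite stab_pattern"
    using finite_pattern by (rule rev_finite_subset) (auto simp: stab_pattern_def)
  ultimately show ?thesis
    by (metis card_0_eq empty_iff mult_right_cancel)
qed

end

lemma system_orbits_reduced_poset:
  assumes "field K" "finite (carrier K)" "poset_system P m {a}"
  shows "system_orbits K P m {a} = poset_classes K (reduced_poset P m a)"
proof -
  interpret field K by fact
  interpret pattern_system K P m a
    using assms by unfold_locales (auto simp: poset_system_def)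
  show ?thesis
    by (rule system_orbits_eq_poset_classes)
qed

section \<open>From the diamond poset to a chain\<close>

lemma poset_system_singletonI:
  assumes "finite_poset P" "less_in P a m" "\<And>y. \<not> less_in P m y"
  shows "poset_system P m {a}"
  using assms
  by (auto simp: poset_system_def max_elements_def antichains_def lower_bounds_def less_in_def
      intro: FieldI1 FieldI2)

lemma chain_poset_Field: "Field (chain_poset n) = {1..n}"
  unfolding Field_def chain_poset_def by force

lemma finite_poset_chain: "finite_poset (chain_poset n)"
  unfolding finite_poset_def chain_poset_Field
  by (auto simp: order_on_defs refl_on_def antisym_def trans_def chain_poset_def)

text \<open>Nothing lies strictly between \<open>n\<close> and \<open>Suc n\<close>, so deleting the
  top element removes no further relation.\<close>

lemma chain_poset_reduced:
  assumes "n \<ge> 1"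
  shows "poset_system (chain_poset (Suc n)) (Suc n) {n}"
    and "reduced_poset (chain_poset (Suc n)) (Suc n) n = chain_poset n"
proof -
  show "poset_system (chain_poset (Suc n)) (Suc n) {n}"
    by (rule poset_system_singletonI[OF finite_poset_chain])
      (use assms in \<open>auto simp: less_in_def chain_poset_def\<close>)
  show "reduced_poset (chain_poset (Suc n)) (Suc n) n = chain_poset n"
    by (auto simp: reduced_poset_def less_in_def chain_poset_def)
qed

text \<open>The reductions \<open>(m, a)\<close> leading from the diamond poset up to \<open>chain_poset 36\<close>, found by a
  computer search. The elements are numbered by their position in that chain.\<close>

definition reductions :: "(nat \<times> nat) list" where
  "reductions =
     [(19, 1), (10, 2), (21, 3), (23, 8), (27, 11), (13, 4), (28, 13), (20, 5), (29, 20), (25, 16),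
      (30, 25), (17, 9), (31, 17), (24, 10), (32, 24), (26, 21), (33, 26), (22, 14), (34, 22),
      (15, 6), (35, 15), (18, 11), (36, 18)]"

text \<open>The tail is carried out first and the head is the last deletion, so dropping
  \<open>i\<close> entries yields the \<open>i\<close>-th poset counted from the diamond.\<close>

fun reduce_all :: "(nat \<times> nat) list \<Rightarrow> nat rel \<Rightarrow> nat rel" where
  "reduce_all [] P = P"
| "reduce_all ((m, a) # s) P = reduced_poset (reduce_all s P) m a"

text \<open>Nested conditionals rather than conjunctions, so that the simplifier decides lazily.\<close>

fun le_after :: "(nat \<times> nat) list \<Rightarrow> nat \<Rightarrow> nat \<Rightarrow> nat \<Rightarrow> bool" where
  "le_after [] n x y \<longleftrightarrow> 1 \<le> x \<and> x \<le> y \<and> y \<le> n"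
| "le_after ((m, a) # s) n x y \<longleftrightarrow>
     (if x = m then False else if y = m then False
      else if x = a then
        if y = a then le_after s n x y else if le_after s n y m then False else le_after s n x y
      else le_after s n x y)"

text \<open>Maximality of \<open>m\<close> is tested only against larger numbers, since every
  surviving relation is one of the chain. The condition \<open>le_after s n a m\<close> also ensures
  that neither element has been deleted before.\<close>

fun valid_reductions :: "(nat \<times> nat) list \<Rightarrow> nat \<Rightarrow> bool" where
  "valid_reductions [] n \<longleftrightarrow> True"
| "valid_reductions ((m, a) # s) n \<longleftrightarrow>
     a \<noteq> m \<and> le_after s n a m \<and> list_all (\<lambda>y. \<not> le_after s n m y) [m + 1..<n + 1] \<and> valid_reductions s n"

lemma reduce_all_chain: "(x, y) \<in> reduce_all s (chain_poset n) \<longleftrightarrow> le_after s n x y"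
  by (induction s n x y rule: le_after.induct)
    (auto simp: chain_poset_def reduced_poset_def less_in_def)

lemma finite_poset_reduce_all: "finite_poset P \<Longrightarrow> finite_poset (reduce_all s P)"
  by (induction s P rule: reduce_all.induct) (auto intro: finite_order.finite_poset_reduced finite_order.intro)

lemma Field_reduce_all:
  "finite_poset P \<Longrightarrow> Field (reduce_all s P) = Field P - fst ` set s"
  by (induction s P rule: reduce_all.induct)
    (auto simp: finite_order.Field_reduced finite_order.intro finite_poset_reduce_all)

lemma le_after_bounds: "le_after s n x y \<Longrightarrow> 1 \<le> x \<and> x \<le> y \<and> y \<le> n"
  by (induction s n x y rule: le_after.induct) (auto split: if_splits)

lemma valid_reductions_drop: "valid_reductions s n \<Longrightarrow> valid_reductions (drop i s) n"
proof (induction i arbitrary: s)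
  case (Suc i)
  then show ?case by (cases s) auto
qed simp

lemma valid_reductions_system:
  assumes "valid_reductions ((m, a) # s) n"
  shows "poset_system (reduce_all s (chain_poset n)) m {a}"
proof (rule poset_system_singletonI)
  show "finite_poset (reduce_all s (chain_poset n))"
    by (intro finite_poset_reduce_all finite_poset_chain)
  show "less_in (reduce_all s (chain_poset n)) a m"
    using assms by (simp add: less_in_def reduce_all_chain)
  fix y
  show "\<not> less_in (reduce_all s (chain_poset n)) m y"
  proof
    assume "less_in (reduce_all s (chain_poset n)) m y"
    then have y: "le_after s n m y" "y \<noteq> m"
      by (auto simp: less_in_def reduce_all_chain)
    then have "y \<in> set [m + 1..<n + 1]"
      using le_after_bounds[OF y(1)] by auto
    then show False
      using assms y(1) unfolding valid_reductions.simps list_all_iff by blast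
  qed
qed

lemma valid_reductions: "valid_reductions reductions 36"
  by (simp add: reductions_def upt_rec_numeral)

text \<open>The transitive closure in closed form, meaningful only on \<open>diamond_ground\<close>.
  The excluded triples show the symmetry: each \<open>T k\<close> misses exactly the two pairs of
  one of the three perfect matchings of four points.\<close>

fun diamond_le :: "diamond_elem \<Rightarrow> diamond_elem \<Rightarrow> bool" where
  "diamond_le (B i) (B j) \<longleftrightarrow> i = j"
| "diamond_le (B i) (C j k) \<longleftrightarrow> i = j \<or> i = k"
| "diamond_le (B i) (T k) \<longleftrightarrow> True"
| "diamond_le (C i j) (C k l) \<longleftrightarrow> i = k \<and> j = l"
| "diamond_le (C i j) (T k) \<longleftrightarrow> (i, j, k) \<notin> {(1, 2, 1), (3, 4, 1), (1, 3, 2), (2, 4, 2), (1, 4, 3), (2, 3, 3)}"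
| "diamond_le (T i) (T j) \<longleftrightarrow> i = j"
| "diamond_le x y \<longleftrightarrow> False"

lemma diamond_le_trans: "diamond_le x y \<Longrightarrow> diamond_le y z \<Longrightarrow> diamond_le x z"
  by (cases x; cases y; cases z) auto

lemma index_pairs:
  "1 \<le> i \<and> i < j \<and> j \<le> 4 \<longleftrightarrow> (i, j) \<in> {(1, 2), (1, 3), (1, 4), (2, 3), (2, 4), (3, 4 :: nat)}"
  by auto

lemma diamond_covers_B_C:
  "C j k \<in> diamond_ground \<Longrightarrow> i = j \<or> i = k \<Longrightarrow> (B i, C j k) \<in> diamond_covers"
  by (auto simp: diamond_ground_def diamond_covers_def)

lemma diamond_covers_C_T:
  assumes "C i j \<in> diamond_ground" "T k \<in> diamond_ground" "diamond_le (C i j) (T k)"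
  shows "(C i j, T k) \<in> diamond_covers"
proof -
  have "\<forall>x\<in>{C 1 2, C 1 3, C 1 4, C 2 3, C 2 4, C 3 4}. \<forall>y\<in>{T 1, T 2, T 3}.
      diamond_le x y \<longrightarrow> (x, y) \<in> diamond_covers"
    by (simp add: diamond_covers_def)
  moreover have "C i j \<in> {C 1 2, C 1 3, C 1 4, C 2 3, C 2 4, C 3 4}" "T k \<in> {T 1, T 2, T 3}"
    using assms(1,2) unfolding diamond_ground_def by simp_all
  ultimately show ?thesis
    using assms(3) by blast
qed

text \<open>Every index lies in three pairs, and \<open>T k\<close> misses only one of them because
  the missed pairs form a matching.\<close>

lemma diamond_covers_B_T:
  assumes i: "B i \<in> diamond_ground" and k: "T k \<in> diamond_ground"
  shows "(B i, T k) \<in> diamond_covers O diamond_covers"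
proof -
  have "\<exists>(j, l)\<in>{(1, 2), (1, 3), (1, 4), (2, 3), (2, 4), (3, 4)}.
      C j l \<in> diamond_ground \<and> (i = j \<or> i = l) \<and> diamond_le (C j l) (T k)"
    using assms by (auto simp: diamond_ground_def)
  then obtain j l where "C j l \<in> diamond_ground" "i = j \<or> i = l" "diamond_le (C j l) (T k)"
    by blast
  then show ?thesis
    using diamond_covers_B_C diamond_covers_C_T k by blast
qed

text \<open>There are three levels, so identity, covers and composites of two covers already exhaust
  \<open>diamond_le\<close>; conversely \<open>diamond_le\<close> contains the covers and is
  transitive.\<close>

lemma diamond_poset_iff:
  "(x, y) \<in> diamond_poset \<longleftrightarrow> x \<in> diamond_ground \<and> y \<in> diamond_ground \<and> diamond_le x y"
proof -
  let ?S = "{(x, y). x \<in> diamond_ground \<and> y \<in> diamond_ground \<and> diamond_le x y}"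
  have "diamond_covers \<subseteq> ?S"
    unfolding diamond_covers_def index_pairs by (auto simp: diamond_ground_def)
  then have "diamond_covers\<^sup>+ \<subseteq> ?S\<^sup>+"
    by (rule trancl_mono_subset)
  moreover have "trans ?S"
    by (rule transI) (use diamond_le_trans in blast)
  then have "?S\<^sup>+ = ?S"
    by (rule trancl_id)
  moreover have "Id_on diamond_ground \<subseteq> ?S"
    by (auto simp: diamond_ground_def)
  moreover have "?S \<subseteq> Id_on diamond_ground \<union> diamond_covers \<union> diamond_covers O diamond_covers"
  proof safe
    fix x y
    assume xy: "x \<in> diamond_ground" "y \<in> diamond_ground" "diamond_le x y"
      and "(x, y) \<notin> diamond_covers O diamond_covers" "(x, y) \<notin> diamond_covers"
    then show "(x, y) \<in> Id_on diamond_ground"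
      using diamond_covers_B_C diamond_covers_C_T diamond_covers_B_T
      by (cases x; cases y) auto
  qed
  moreover have "diamond_covers O diamond_covers \<subseteq> diamond_covers\<^sup>+"
    by (auto intro: trancl_into_trancl)
  ultimately have "diamond_poset = ?S"
    unfolding diamond_poset_def by blast
  then have "(x, y) \<in> diamond_poset \<longleftrightarrow> (x, y) \<in> ?S"
    by (rule arg_cong)
  then show ?thesis
    by (simp only: mem_Collect_eq prod.case)
qed

text \<open>The values are the thirteen numbers up to 36 that \<open>reductions\<close> never
  deletes, arranged as a linear extension of the diamond poset. The last \<open>else\<close>
  branches stand for the one remaining index of the ground set.\<close>

fun diamond_label :: "diamond_elem \<Rightarrow> nat" where
  "diamond_label (B i) = (if i = 3 then 7 else i)"
| "diamond_label (C i j) =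
     (if i = 1 then (if j = 2 then 3 else if j = 3 then 8 else 5)
      else if i = 2 then (if j = 3 then 12 else 6) else 9)"
| "diamond_label (T k) = (if k = 1 then 16 else if k = 2 then 14 else 11)"

lemma poset_iso_diamond: "poset_iso diamond_poset (reduce_all reductions (chain_poset 36))"
proof -
  have F: "Field diamond_poset = diamond_ground"
  proof
    show "Field diamond_poset \<subseteq> diamond_ground"
      by (auto simp: Field_def diamond_poset_iff)
    show "diamond_ground \<subseteq> Field diamond_poset"
      by (auto simp: diamond_poset_def intro: FieldI1)
  qed
  have F': "Field (reduce_all reductions (chain_poset 36)) = diamond_label ` diamond_ground"
    unfolding Field_reduce_all[OF finite_poset_chain] chain_poset_Field
    by (simp add: reductions_def diamond_ground_def Icc_eq_insert_lb_nat insert_Diff_if) auto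
  have "\<forall>x\<in>diamond_ground. \<forall>y\<in>diamond_ground. diamond_label x = diamond_label y \<longrightarrow> x = y"
    by (simp add: diamond_ground_def)
  then have "inj_on diamond_label diamond_ground"
    by (simp only: inj_on_def)
  \<comment> \<open>All 169 pairs are decided by evaluating both orders.\<close>
  moreover have "\<forall>x\<in>diamond_ground. \<forall>y\<in>diamond_ground.
      diamond_le x y \<longleftrightarrow> le_after reductions 36 (diamond_label x) (diamond_label y)"
    by (simp add: diamond_ground_def reductions_def)
  ultimately show ?thesis
    unfolding poset_iso_def F F' diamond_poset_iff reduce_all_chain
    by (intro exI[of _ diamond_label]) (auto simp: bij_betw_def)
qed

theorem theorem1p5:
  shows "diamond_poset \<leadsto> chain_poset 59"
proof -
  \<comment> \<open>\<open>R i\<close> has \<open>13 + i\<close> elements, so the chain with 59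
    elements is reached at \<open>i = 46\<close>.\<close>
  define R where "R i = (if i \<le> 23 then reduce_all (drop i reductions) (chain_poset 36) else chain_poset (13 + i))" for i
  \<comment> \<open>The index is shifted by one: system \<open>i\<close> lives on \<open>R i\<close>
    and reduces it to \<open>R (i - 1)\<close>, whose list has the entry at position
    \<open>i - 1\<close> as its head.\<close>
  define m where "m i = (if i \<le> 23 then fst (reductions ! (i - 1)) else 13 + i)" for i
  define a where "a i = (if i \<le> 23 then snd (reductions ! (i - 1)) else 12 + i)" for i
  have len: "length reductions = 23"
    by (simp add: reductions_def)
  have step: "poset_system (R (i + 1)) (m (i + 1)) {a (i + 1)} \<and>
      reduced_poset (R (i + 1)) (m (i + 1)) (a (i + 1)) = R i" for i
  proof (cases "i < 23")
    case True
    then have drop: "drop i reductions = (m (i + 1), a (i + 1)) # drop (i + 1) reductions"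
      using Cons_nth_drop_Suc[of i reductions] len by (simp add: m_def a_def)
    then have "valid_reductions ((m (i + 1), a (i + 1)) # drop (i + 1) reductions) 36"
      using valid_reductions_drop[OF valid_reductions] by metis
    then have "poset_system (reduce_all (drop (i + 1) reductions) (chain_poset 36)) (m (i + 1)) {a (i + 1)}"
      by (rule valid_reductions_system)
    moreover have "R (i + 1) = reduce_all (drop (i + 1) reductions) (chain_poset 36)"
        "R i = reduce_all (drop i reductions) (chain_poset 36)"
      using True by (simp_all add: R_def)
    ultimately show ?thesis
      by (simp only: drop reduce_all.simps simp_thms)
  next
    case False
    \<comment> \<open>At \<open>i = 23\<close> the list is used up, and what remains is the chain
      with \<open>36 = 13 + 23\<close> elements.\<close>
    then have "R i = chain_poset (13 + i)"
      using len by (cases "i = 23") (auto simp: R_def)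
    then show ?thesis
      using chain_poset_reduced[of "13 + i"] False by (simp add: R_def m_def a_def)
  qed
  have "\<forall>i\<le>46. finite_poset (R i)"
    by (simp add: R_def finite_poset_reduce_all finite_poset_chain)
  moreover have "poset_iso diamond_poset (R 0)"
    using poset_iso_diamond by (simp add: R_def)
  moreover have "poset_iso (R 46) (chain_poset 59)"
    unfolding poset_iso_def by (rule exI[of _ id]) (simp add: R_def)
  moreover have "\<forall>i\<in>{1..46}. poset_system (R i) (m i) {a i}"
    using step by (metis atLeastAtMost_iff le_add_diff_inverse2)
  moreover have "\<forall>i<46. \<forall>K :: nat ring. field K \<and> finite (carrier K) \<longrightarrow>
      poset_classes K (R i) = system_orbits K (R (i + 1)) (m (i + 1)) {a (i + 1)}"
    using step system_orbits_reduced_poset by metis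
  ultimately show ?thesis
    unfolding embeds_def by (intro exI[of _ 46] exI[of _ R] exI[of _ m] exI[of _ "\<lambda>i. {a i}"]) blast
qed

end
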